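(* Let $n\geq 2$. An ovoidal subspace $\mathcal{S}$ of a generalised $2n$-gon $\Gamma=(\mathcal{P},\mathcal{L},\mathbf{I})$ is either: (1) a distance $n$-ovoid; or (2) a large full subpolygon; or (3) the ball $B_n(x)=\{y\in\mathcal{P}\cup\mathcal{L}\mid d(x,y)\leq n\}$ of radius $n$ centred at an element $x\in\mathcal{P}\cup\mathcal{L}$; moreover, if $n$ is even then $x\in\mathcal{P}$, and if $n$ is odd then $x\in\mathcal{L}$.
   Context: A generalised $k$-gon ($k\geq 2$) is a nonempty point-line geometry $\Gamma=(\mathcal{P},\mathcal{L},\mathbf{I})$ containing no ordinary $j$-gon (as a subgeometry) for $2\leq j<k$ and such that any two elements of $\mathcal{P}\cup\mathcal{L}$ are contained in some ordinary $k$-gon in $\Gamma$ (thickness is not assumed). Let $d(x,y)$ be the distance in the incidence graph (vertex set $\mathcal{P}\cup\mathcal{L}$, edges the incident pairs). In a generalised $2n$-gon, $x$ and $y$ are opposite if $d(x,y)=2n$. A subspace of a generalised $2n$-gon $\Gamma$ is a subset $\mathcal{S}\subseteq\mathcal{P}\cup\mathcal{L}$ such that (i) if $x,y\in\mathcal{S}$ are distinct collinear points then the line determined by $x$ and $y$ is in $\mathcal{S}$, and (ii) if a line $L$ is in $\mathcal{S}$ then all points on $L$ are in $\mathcal{S}$. A subspace $\mathcal{S}$ is ovoidal if (a) for every $x\in\mathcal{P}\cup\mathcal{L}$ there is $y\in\mathcal{S}$ with $d(x,y)\leq n$, and (b) if $x\in\mathcal{P}\cup\mathcal{L}$ and $y\in\mathcal{S}$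 with $d(x,y)<n$ then $x$ is at minimal distance from a unique element of $\mathcal{S}$. A distance $n$-ovoid in $\Gamma$ is a set of mutually opposite points such that every element of $\Gamma$ is at distance at most $n$ from some element of the set. A subpolygon $\Gamma'$ of $\Gamma$ is a subgeometry that is itself a generalised $2n$-gon (not necessarily thick). It is full if every point of $\Gamma$ incident with a line of $\Gamma'$ belongs to $\Gamma'$, and large if every element of $\Gamma$ is at distance at most $n$ from some element of $\Gamma'$. *)

theory Defs
  imports Main "HOL-Library.Extended_Nat"
begin

text \<open>
  Points and lines live in one type, so that the set of elements is literally
  \<open>points \<Gamma> \<union> lines \<Gamma>\<close>; \<open>geometry\<close> requires the two sorts to be disjoint.
\<close>

record 'a geometry =
  points :: "'a set"
  lines :: "'a set"
  incid :: "('a \<times> 'a) set"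

definition geometry :: "'a geometry \<Rightarrow> bool" where
  "geometry \<Gamma> \<longleftrightarrow>
     points \<Gamma> \<inter> lines \<Gamma> = {} \<and> incid \<Gamma> \<subseteq> points \<Gamma> \<times> lines \<Gamma>"

definition elements :: "'a geometry \<Rightarrow> 'a set" where
  "elements \<Gamma> = points \<Gamma> \<union> lines \<Gamma>"

text \<open>
  The distance in the incidence graph is the least length of a walk along the
  symmetrised incidence relation; it is infinite if there is no such walk.
\<close>

definition inc_dist :: "'a geometry \<Rightarrow> 'a \<Rightarrow> 'a \<Rightarrow> enat" where
  "inc_dist \<Gamma> x y =
     (INF k \<in> {k. (x, y) \<in> (incid \<Gamma> \<union> (incid \<Gamma>)\<inverse>) ^^ k}. enat k)"

text \<open>Subgeometries carry the induced incidence relation.\<close>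

definition subgeometry :: "'a geometry \<Rightarrow> 'a geometry \<Rightarrow> bool" where
  "subgeometry \<Delta> \<Gamma> \<longleftrightarrow>
     points \<Delta> \<subseteq> points \<Gamma> \<and> lines \<Delta> \<subseteq> lines \<Gamma> \<and>
     incid \<Delta> = incid \<Gamma> \<inter> (points \<Delta> \<times> lines \<Delta>)"

text \<open>
  An ordinary \<open>j\<close>-gon has vertices \<open>p 0, \<dots>, p (j - 1)\<close> and sides
  \<open>l 0, \<dots>, l (j - 1)\<close>, where \<open>l i\<close> joins \<open>p i\<close> to the cyclically next vertex.
  It is meant for \<open>j \<ge> 2\<close>; for \<open>j = 2\<close> both points are on both lines.
\<close>

definition ordinary_polygon :: "nat \<Rightarrow> 'a geometry \<Rightarrow> bool" where
  "ordinary_polygon j \<Delta> \<longleftrightarrow>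
     (\<exists>p l. bij_betw p {..<j} (points \<Delta>) \<and> bij_betw l {..<j} (lines \<Delta>) \<and>
        incid \<Delta> = (\<Union>i<j. {(p i, l i), (p (Suc i mod j), l i)}))"

definition generalised_polygon :: "nat \<Rightarrow> 'a geometry \<Rightarrow> bool" where
  "generalised_polygon k \<Gamma> \<longleftrightarrow>
     k \<ge> 2 \<and> geometry \<Gamma> \<and> elements \<Gamma> \<noteq> {} \<and>
     (\<forall>j. 2 \<le> j \<and> j < k \<longrightarrow> \<not> (\<exists>\<Delta>. subgeometry \<Delta> \<Gamma> \<and> ordinary_polygon j \<Delta>)) \<and>
     (\<forall>x \<in> elements \<Gamma>. \<forall>y \<in> elements \<Gamma>.
        \<exists>\<Delta>. subgeometry \<Delta> \<Gamma> \<and> ordinary_polygon k \<Delta> \<and> x \<in> elements \<Delta> \<and> y \<in> elements \<Delta>)"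

text \<open>
  In the notions below, \<open>n\<close> is half the gonality of the ambient polygon \<open>\<Gamma>\<close>.
\<close>

definition opposite :: "nat \<Rightarrow> 'a geometry \<Rightarrow> 'a \<Rightarrow> 'a \<Rightarrow> bool" where
  "opposite n \<Gamma> x y \<longleftrightarrow> inc_dist \<Gamma> x y = enat (2 * n)"

text \<open>
  Two distinct collinear points of a generalised \<open>2n\<close>-gon with \<open>n \<ge> 2\<close> are on
  exactly one common line, as there are no ordinary 2-gons; hence quantifying over
  all common lines refers to the line determined by the two points.
\<close>

definition subspace :: "'a geometry \<Rightarrow> 'a set \<Rightarrow> bool" where
  "subspace \<Gamma> S \<longleftrightarrow>
     S \<subseteq> elements \<Gamma> \<and>
     (\<forall>x \<in> S \<inter> points \<Gamma>. \<forall>y \<in> S \<inter> points \<Gamma>. \<forall>L \<in> lines \<Gamma>.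
        x \<noteq> y \<and> (x, L) \<in> incid \<Gamma> \<and> (y, L) \<in> incid \<Gamma> \<longrightarrow> L \<in> S) \<and>
     (\<forall>L \<in> S \<inter> lines \<Gamma>. \<forall>x \<in> points \<Gamma>. (x, L) \<in> incid \<Gamma> \<longrightarrow> x \<in> S)"

definition ovoidal_subspace :: "nat \<Rightarrow> 'a geometry \<Rightarrow> 'a set \<Rightarrow> bool" where
  "ovoidal_subspace n \<Gamma> S \<longleftrightarrow>
     subspace \<Gamma> S \<and>
     (\<forall>x \<in> elements \<Gamma>. \<exists>y \<in> S. inc_dist \<Gamma> x y \<le> enat n) \<and>
     (\<forall>x \<in> elements \<Gamma>. \<forall>y \<in> S. inc_dist \<Gamma> x y < enat n \<longrightarrow>
        (\<exists>!z. z \<in> S \<and> (\<forall>w \<in> S. inc_dist \<Gamma> x z \<le> inc_dist \<Gamma> x w)))"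

definition distance_ovoid :: "nat \<Rightarrow> 'a geometry \<Rightarrow> 'a set \<Rightarrow> bool" where
  "distance_ovoid n \<Gamma> S \<longleftrightarrow>
     S \<subseteq> points \<Gamma> \<and>
     (\<forall>x \<in> S. \<forall>y \<in> S. x \<noteq> y \<longrightarrow> opposite n \<Gamma> x y) \<and>
     (\<forall>x \<in> elements \<Gamma>. \<exists>y \<in> S. inc_dist \<Gamma> x y \<le> enat n)"

definition subpolygon :: "nat \<Rightarrow> 'a geometry \<Rightarrow> 'a geometry \<Rightarrow> bool" where
  "subpolygon n \<Delta> \<Gamma> \<longleftrightarrow> subgeometry \<Delta> \<Gamma> \<and> generalised_polygon (2 * n) \<Delta>"

definition full_in :: "'a geometry \<Rightarrow> 'a geometry \<Rightarrow> bool" where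
  "full_in \<Delta> \<Gamma> \<longleftrightarrow>
     (\<forall>L \<in> lines \<Delta>. \<forall>x \<in> points \<Gamma>. (x, L) \<in> incid \<Gamma> \<longrightarrow> x \<in> points \<Delta>)"

definition large_in :: "nat \<Rightarrow> 'a geometry \<Rightarrow> 'a geometry \<Rightarrow> bool" where
  "large_in n \<Delta> \<Gamma> \<longleftrightarrow>
     (\<forall>x \<in> elements \<Gamma>. \<exists>y \<in> elements \<Delta>. inc_dist \<Gamma> x y \<le> enat n)"

definition inc_ball :: "'a geometry \<Rightarrow> nat \<Rightarrow> 'a \<Rightarrow> 'a set" where
  "inc_ball \<Gamma> r x = {y \<in> elements \<Gamma>. inc_dist \<Gamma> x y \<le> enat r}"

end

theory Submission
  imports Defs
begin

text \<open>
  Work in the incidence graph, where an absence of closed non-backtracking walks of length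
  below \<open>4 * n\<close> makes every non-backtracking walk of length at most \<open>2 * n\<close> a geodesic.
  An ovoidal subspace \<open>S\<close> contains every geodesic of length less than \<open>2 * n\<close> between two of
  its elements. Hence, if \<open>S\<close> has no lines, its points are mutually opposite. If \<open>S\<close> contains
  a closed non-backtracking walk of length \<open>4 * n\<close>, every element of \<open>S\<close> has two neighbours in
  \<open>S\<close> and any two elements of \<open>S\<close> lie on such a walk in \<open>S\<close>. Otherwise the diameter of \<open>S\<close> is
  \<open>2 * n\<close>, since a smaller diameter \<open>2 * k\<close> puts \<open>S\<close> into a ball of radius \<open>k < n\<close> around some
  \<open>m\<close>, too far from an element opposite \<open>m\<close>; and \<open>S\<close> is the ball of radius \<open>n\<close> around the
  midpoint of a geodesic between two opposite points of \<open>S\<close>.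
\<close>

section \<open>Non-backtracking walks in a relation\<close>

text \<open>Only the values on \<open>{0..k}\<close> matter, so prefixes, shifts and reversals are
  again walks in this sense. A closed walk carries no turn condition at its base point.\<close>

definition nb_walk :: "('a \<times> 'a) set \<Rightarrow> (nat \<Rightarrow> 'a) \<Rightarrow> nat \<Rightarrow> bool" where
  "nb_walk E f k \<longleftrightarrow>
     (\<forall>i<k. (f i, f (Suc i)) \<in> E) \<and> (\<forall>i. Suc i < k \<longrightarrow> f i \<noteq> f (Suc (Suc i)))"

definition glue :: "nat \<Rightarrow> (nat \<Rightarrow> 'a) \<Rightarrow> (nat \<Rightarrow> 'a) \<Rightarrow> nat \<Rightarrow> 'a" where
  "glue a f g = (\<lambda>i. if i \<le> a then f i else g (i - a))"

lemma nb_walk_edge: "nb_walk E f k \<Longrightarrow> i < k \<Longrightarrow> (f i, f (Suc i)) \<in> E"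
  by (simp add: nb_walk_def)

lemma nb_walk_turn: "nb_walk E f k \<Longrightarrow> Suc i < k \<Longrightarrow> f i \<noteq> f (Suc (Suc i))"
  by (simp add: nb_walk_def)

lemma nb_walk_0 [simp]: "nb_walk E f 0"
  by (simp add: nb_walk_def)

lemma nb_walk_le: "nb_walk E f k \<Longrightarrow> j \<le> k \<Longrightarrow> nb_walk E f j"
  by (simp add: nb_walk_def)

lemma nb_walk_shift: "nb_walk E f k \<Longrightarrow> a + j \<le> k \<Longrightarrow> nb_walk E (\<lambda>i. f (a + i)) j"
  by (auto simp: nb_walk_def)

lemma nb_walk_rev:
  assumes "sym E" "nb_walk E f k"
  shows "nb_walk E (\<lambda>i. f (k - i)) k"
  unfolding nb_walk_def
proof (intro conjI allI impI)
  fix i assume "i < k"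
  then have "(f (k - Suc i), f (Suc (k - Suc i))) \<in> E"
    using assms(2) by (intro nb_walk_edge) auto
  then show "(f (k - i), f (k - Suc i)) \<in> E"
    using \<open>i < k\<close> assms(1) by (auto simp: Suc_diff_Suc dest: symD)
next
  fix i assume i: "Suc i < k"
  then have "f (k - Suc (Suc i)) \<noteq> f (Suc (Suc (k - Suc (Suc i))))"
    using assms(2) by (intro nb_walk_turn) auto
  then show "f (k - i) \<noteq> f (k - Suc (Suc i))"
    using i by (auto simp: Suc_diff_Suc)
qed

lemma nb_walk_glue:
  assumes "nb_walk E f a" "nb_walk E g b" "f a = g 0"
    and "0 < a \<Longrightarrow> 0 < b \<Longrightarrow> f (a - 1) \<noteq> g 1"
  shows "nb_walk E (glue a f g) (a + b)"
  unfolding nb_walk_def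
proof (intro conjI allI impI)
  fix i assume i: "i < a + b"
  consider "i < a" | "i = a" | "a < i" by linarith
  then show "(glue a f g i, glue a f g (Suc i)) \<in> E"
  proof cases
    case 1 then show ?thesis using assms(1) by (simp add: glue_def nb_walk_edge)
  next
    case 2 then show ?thesis
      using i assms(3) nb_walk_edge[OF assms(2), of 0] by (simp add: glue_def)
  next
    case 3 then show ?thesis
      using i nb_walk_edge[OF assms(2), of "i - a"] by (simp add: glue_def Suc_diff_le)
  qed
next
  fix i assume i: "Suc i < a + b"
  consider "Suc i < a" | "Suc i = a" | "i = a" | "a < i" by linarith
  then show "glue a f g i \<noteq> glue a f g (Suc (Suc i))"
  proof cases
    case 1 then show ?thesis using assms(1) by (simp add: glue_def nb_walk_turn)
  next
    case 2 then show ?thesis using i assms(4) by (auto simp: glue_def)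
  next
    case 3 then show ?thesis
      using i assms(3) nb_walk_turn[OF assms(2), of 0] by (simp add: glue_def numeral_2_eq_2)
  next
    case 4 then show ?thesis
      using i nb_walk_turn[OF assms(2), of "i - a"] by (simp add: glue_def Suc_diff_le)
  qed
qed

lemma glue_left [simp]: "i \<le> a \<Longrightarrow> glue a f g i = f i"
  by (simp add: glue_def)

lemma glue_add [simp]: "f a = g 0 \<Longrightarrow> glue a f g (a + i) = g i"
  by (auto simp: glue_def)

lemma glue_in:
  assumes "\<And>i. i \<le> a \<Longrightarrow> f i \<in> T" "\<And>i. i \<le> b \<Longrightarrow> g i \<in> T" "i \<le> a + b"
  shows "glue a f g i \<in> T"
  using assms by (auto simp: glue_def)

lemma nb_walk_snoc:
  assumes "nb_walk E f k" "(f k, z) \<in> E" "0 < k \<Longrightarrow> z \<noteq> f (k - 1)"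
  shows "nb_walk E (f(Suc k := z)) (Suc k)"
  unfolding nb_walk_def
proof (intro conjI allI impI)
  fix i assume "i < Suc k"
  then show "((f(Suc k := z)) i, (f(Suc k := z)) (Suc i)) \<in> E"
    using assms(2) nb_walk_edge[OF assms(1), of i] by (cases "i = k") auto
next
  fix i assume i: "Suc i < Suc k"
  show "(f(Suc k := z)) i \<noteq> (f(Suc k := z)) (Suc (Suc i))"
  proof (cases "Suc i = k")
    case True
    then show ?thesis using assms(3) by auto
  next
    case False
    then show ?thesis using i nb_walk_turn[OF assms(1), of i] by simp
  qed
qed

lemma nb_walk_Cons:
  assumes "nb_walk E f k" "(x, f 0) \<in> E" "0 < k \<Longrightarrow> x \<noteq> f 1"
  shows "nb_walk E (case_nat x f) (Suc k)"
  unfolding nb_walk_def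
proof (intro conjI allI impI)
  fix i assume "i < Suc k"
  then show "(case_nat x f i, case_nat x f (Suc i)) \<in> E"
    using assms(2) nb_walk_edge[OF assms(1)] by (cases i) auto
next
  fix i assume "Suc i < Suc k"
  then show "case_nat x f i \<noteq> case_nat x f (Suc (Suc i))"
    using assms(3) nb_walk_turn[OF assms(1)] by (cases i) auto
qed

lemma nb_walk_relpow: "nb_walk E f k \<Longrightarrow> (f 0, f k) \<in> E ^^ k"
  unfolding relpow_fun_conv nb_walk_def by blast

text \<open>A backtrack could be cut out, leaving a walk two steps shorter.\<close>

lemma shortest_walk_nb:
  assumes "(x, y) \<in> E ^^ k" and min: "\<And>j. (x, y) \<in> E ^^ j \<Longrightarrow> k \<le> j"
  shows "\<exists>f. nb_walk E f k \<and> f 0 = x \<and> f k = y"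
proof -
  obtain f where f: "f 0 = x" "f k = y" "\<forall>i<k. (f i, f (Suc i)) \<in> E"
    using assms(1) relpow_fun_conv[of x y k E] by auto
  have "f i \<noteq> f (Suc (Suc i))" if i: "Suc i < k" for i
  proof
    assume eq: "f i = f (Suc (Suc i))"
    have "(f 0, f i) \<in> E ^^ i"
      unfolding relpow_fun_conv using f i by (intro exI[of _ f]) auto
    moreover have "(f (Suc (Suc i)), f k) \<in> E ^^ (k - Suc (Suc i))"
      unfolding relpow_fun_conv
    proof (intro exI[of _ "\<lambda>j. f (Suc (Suc i) + j)"] conjI allI impI)
      show "f (Suc (Suc i) + (k - Suc (Suc i))) = f k"
        using i by (intro arg_cong[of _ _ f]) simp
    qed (use f i in auto)
    ultimately have "(x, y) \<in> E ^^ (i + (k - Suc (Suc i)))"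
      unfolding relpow_add using f eq by auto
    from min[OF this] show False using i by simp
  qed
  then show ?thesis using f unfolding nb_walk_def by blast
qed

text \<open>Of two neighbours in \<open>T\<close>, one differs from the element just left, so the
  walk never gets stuck.\<close>

lemma nb_walk_extend:
  assumes T: "\<And>v. v \<in> T \<Longrightarrow> \<exists>a\<in>T. \<exists>b\<in>T. a \<noteq> b \<and> (v, a) \<in> E \<and> (v, b) \<in> E"
    and "nb_walk E f k" "f k \<in> T"
  shows "\<exists>g. nb_walk E g (k + j) \<and> (\<forall>i\<le>k. g i = f i) \<and> (\<forall>i. k \<le> i \<and> i \<le> k + j \<longrightarrow> g i \<in> T)"
proof (induction j)
  case 0
  then show ?case using assms by (intro exI[of _ f]) auto
next
  case (Suc j)
  then obtain g where g: "nb_walk E g (k + j)" "\<forall>i\<le>k. g i = f i"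
      "\<forall>i. k \<le> i \<and> i \<le> k + j \<longrightarrow> g i \<in> T" by blast
  \<comment> \<open>For \<open>k + j = 0\<close> there is no previous element;
    \<open>k + j - 1\<close> is then \<open>0\<close>, and the condition only excludes the current
    element.\<close>
  then obtain z where z: "z \<in> T" "(g (k + j), z) \<in> E" "z \<noteq> g (k + j - 1)"
    using T[of "g (k + j)"] by (metis le_add1 order_refl)
  define g' where "g' = g(Suc (k + j) := z)"
  have "nb_walk E g' (k + Suc j)"
    using g z unfolding g'_def add_Suc_right by (intro nb_walk_snoc) auto
  moreover have "\<forall>i\<le>k. g' i = f i" "\<forall>i. k \<le> i \<and> i \<le> k + Suc j \<longrightarrow> g' i \<in> T"
    using g z by (auto simp: g'_def le_Suc_eq)
  ultimately show ?case by blast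
qed

section \<open>The incidence graph and its bipartition\<close>

definition adj :: "'a geometry \<Rightarrow> ('a \<times> 'a) set" where
  "adj \<Gamma> = incid \<Gamma> \<union> (incid \<Gamma>)\<inverse>"

lemma sym_adj: "sym (adj \<Gamma>)"
  by (auto simp: adj_def sym_def)

lemma adj_sym: "(x, y) \<in> adj \<Gamma> \<Longrightarrow> (y, x) \<in> adj \<Gamma>"
  by (auto simp: adj_def)

lemma adj_elements: "geometry \<Gamma> \<Longrightarrow> (x, y) \<in> adj \<Gamma> \<Longrightarrow> x \<in> elements \<Gamma> \<and> y \<in> elements \<Gamma>"
  by (auto simp: adj_def geometry_def elements_def)

lemma adj_points: "geometry \<Gamma> \<Longrightarrow> (x, y) \<in> adj \<Gamma> \<Longrightarrow> y \<in> points \<Gamma> \<longleftrightarrow> x \<notin> points \<Gamma>"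
  by (auto simp: adj_def geometry_def)

lemma adj_incid: "geometry \<Gamma> \<Longrightarrow> (x, y) \<in> adj \<Gamma> \<Longrightarrow> x \<in> points \<Gamma> \<Longrightarrow> (x, y) \<in> incid \<Gamma>"
  by (auto simp: adj_def geometry_def)

lemma nb_walk_edge_back:
  assumes "nb_walk (adj \<Gamma>) f k" "0 < i" "i \<le> k"
  shows "(f i, f (i - 1)) \<in> adj \<Gamma>"
  using nb_walk_edge[OF assms(1), of "i - 1"] assms(2,3) by (simp add: adj_sym)

lemma nb_walk_parity:
  assumes "geometry \<Gamma>" "nb_walk (adj \<Gamma>) f k" "i \<le> k"
  shows "f i \<in> points \<Gamma> \<longleftrightarrow> (f 0 \<in> points \<Gamma> \<longleftrightarrow> even i)"
  using assms(3)
proof (induction i)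
  case (Suc i)
  then show ?case
    using adj_points[OF assms(1) nb_walk_edge[OF assms(2), of i]] by auto
qed simp

section \<open>Closed walks and ordinary polygons\<close>

text \<open>For \<open>adj \<Gamma>\<close> this says that the girth is at least \<open>L\<close>.
  Walks that backtrack at their base point are covered too: trimming both ends turns them into
  shorter closed walks without that defect.\<close>

definition acyclic_below :: "('a \<times> 'a) set \<Rightarrow> nat \<Rightarrow> bool" where
  "acyclic_below E L \<longleftrightarrow> (\<forall>f j. 0 < j \<and> j < L \<and> nb_walk E f j \<longrightarrow> f 0 \<noteq> f j)"

lemma acyclic_belowD: "acyclic_below E L \<Longrightarrow> 0 < j \<Longrightarrow> j < L \<Longrightarrow> nb_walk E f j \<Longrightarrow> f 0 \<noteq> f j"
  by (auto simp: acyclic_below_def)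

text \<open>A repeated entry would cut out a closed walk shorter than \<open>L\<close>.\<close>

lemma closed_nb_walk_inj:
  assumes "nb_walk E h L"
    and short: "acyclic_below E L"
  shows "inj_on h {..<L}"
proof -
  have "h i \<noteq> h j" if "i < j" "j < L" for i j
    using acyclic_belowD[OF short, of "j - i" "\<lambda>m. h (i + m)"]
      nb_walk_shift[OF assms(1), of i "j - i"] that by simp
  then show ?thesis
    by (intro inj_onI) (metis lessThan_iff linorder_neqE_nat)
qed

text \<open>The stretch from \<open>h i\<close> to \<open>h j\<close> followed by the chord is a
  closed walk of length \<open>j - i + 1\<close>. It does not backtrack unless
  \<open>j = Suc i\<close>, and it is too short unless it is the whole of \<open>h\<close>.\<close>

lemma closed_nb_walk_chord:
  assumes "nb_walk E h L"
    and short: "acyclic_below E L"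
    and "i < j" "j < L" "(h j, h i) \<in> E"
  shows "j = Suc i \<or> (i = 0 \<and> Suc j = L)"
proof (rule ccontr)
  assume neg: "\<not> ?thesis"
  have inj: "inj_on h {..<L}" by (rule closed_nb_walk_inj[OF assms(1) short])
  have "nb_walk E (\<lambda>m. h (i + m)) (j - i)"
    using assms by (intro nb_walk_shift) auto
  then have "nb_walk E ((\<lambda>m. h (i + m))(Suc (j - i) := h i)) (Suc (j - i))"
  proof (rule nb_walk_snoc)
    show "(h (i + (j - i)), h i) \<in> E" using assms by simp
    show "h i \<noteq> h (i + (j - i - 1))"
      using inj_onD[OF inj, of i "i + (j - i - 1)"] assms neg by auto
  qed
  moreover have "Suc (j - i) < L" using neg assms(3,4) by arith
  ultimately show False
    using acyclic_belowD[OF short, of "Suc (j - i)" "(\<lambda>m. h (i + m))(Suc (j - i) := h i)"]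
    by simp
qed

text \<open>Moving the base point one step on turns a closed walk based at a line into one based at
  a point. Nothing is known of \<open>h (L + 1)\<close>, which is why index \<open>L\<close> gets
  the value \<open>h 1\<close>.\<close>

lemma closed_nb_walk_rotate:
  assumes h: "nb_walk E h L" "h 0 = h L" and L: "3 \<le> L"
    and short: "acyclic_below E L"
  shows "nb_walk E (\<lambda>i. if i < L then h (Suc i) else h 1) L"
    and "(\<lambda>i. if i < L then h (Suc i) else h 1) ` {..<L} = h ` {..<L}"
proof -
  have inj: "inj_on h {..<L}" by (rule closed_nb_walk_inj[OF h(1) short])
  \<comment> \<open>The turn at the old base point, which \<open>nb_walk E h L\<close> does not
    contain; \<open>3 \<le> L\<close> keeps the two indices distinct.\<close>
  have "h (L - 1) \<noteq> h 1" using inj_onD[OF inj, of "L - 1" 1] L by auto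
  then have turn: "h (Suc i) \<noteq> h 1" if "Suc (Suc i) = L" for i using that by auto
  show "nb_walk E (\<lambda>i. if i < L then h (Suc i) else h 1) L"
    unfolding nb_walk_def
  proof (intro conjI allI impI)
    fix i assume i: "i < L"
    show "(if i < L then h (Suc i) else h 1, if Suc i < L then h (Suc (Suc i)) else h 1) \<in> E"
    proof (cases "Suc i < L")
      case True then show ?thesis using nb_walk_edge[OF h(1), of "Suc i"] by simp
    next
      case False
      then have "Suc i = L" using i by simp
      then show ?thesis using nb_walk_edge[OF h(1), of 0] h(2) L by auto
    qed
  next
    fix i assume i: "Suc i < L"
    then consider "Suc (Suc i) = L" | "Suc (Suc i) < L" by linarith
    then show "(if i < L then h (Suc i) else h 1) \<noteq>
        (if Suc (Suc i) < L then h (Suc (Suc (Suc i))) else h 1)"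
      by cases (use i turn nb_walk_turn[OF h(1), of "Suc i"] in auto)
  qed
  have "(\<lambda>i. if i < L then h (Suc i) else h 1) ` {..<L} = h ` Suc ` {..<L}"
    by (auto simp: image_image)
  also have "\<dots> = h ` {1..L}"
    by (metis One_nat_def atLeast0LessThan atLeastLessThanSuc_atLeastAtMost image_Suc_atLeastLessThan)
  also have "\<dots> = h ` {..<L}"
  proof (intro equalityI subsetI)
    fix v assume "v \<in> h ` {1..L}"
    then obtain i where "v = h i" "i \<le> L" by auto
    then show "v \<in> h ` {..<L}"
      using h(2) L by (cases "i = L") (auto intro!: image_eqI[of _ _ 0])
  next
    fix v assume "v \<in> h ` {..<L}"
    then obtain i where "v = h i" "i < L" by auto
    then show "v \<in> h ` {1..L}"
      using h(2) L by (cases "i = 0") (auto intro!: image_eqI[of _ _ L])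
  qed
  finally show "(\<lambda>i. if i < L then h (Suc i) else h 1) ` {..<L} = h ` {..<L}" .
qed

text \<open>Even entries are the vertices, odd entries the sides. Injectivity makes both
  enumerations bijective, and the absence of chords shows that the induced incidence relates
  consecutive entries only.\<close>

lemma closed_nb_walk_polygon_at_point:
  assumes geo: "geometry \<Gamma>" and h: "nb_walk (adj \<Gamma>) h (2 * q)" "h 0 = h (2 * q)"
    and pt: "h 0 \<in> points \<Gamma>" and q: "2 \<le> q"
    and short: "acyclic_below (adj \<Gamma>) (2 * q)"
  shows "\<exists>\<Delta>. subgeometry \<Delta> \<Gamma> \<and> ordinary_polygon q \<Delta> \<and> elements \<Delta> = h ` {..<2 * q}"
proof -
  define p where "p i = h (2 * i)" for i
  define l where "l i = h (2 * i + 1)" for i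
  define \<Delta> where "\<Delta> = \<lparr>points = p ` {..<q}, lines = l ` {..<q},
      incid = incid \<Gamma> \<inter> (p ` {..<q} \<times> l ` {..<q})\<rparr>"
  have inj: "inj_on h {..<2 * q}" by (rule closed_nb_walk_inj[OF h(1) short])
  have pts: "p i \<in> points \<Gamma>" if "i < q" for i
    using nb_walk_parity[OF geo h(1), of "2 * i"] pt that by (simp add: p_def)
  have lns: "l i \<in> lines \<Gamma>" if "i < q" for i
    using nb_walk_parity[OF geo h(1), of "2 * i + 1"] pt that
      adj_elements[OF geo nb_walk_edge[OF h(1), of "2 * i"]] by (auto simp: l_def elements_def)
  have p_next: "p (Suc i mod q) = h (Suc (2 * i + 1))" if "i < q" for i
    using that h(2) by (cases "Suc i = q") (auto simp: p_def)
  have edge: "(p i, l i) \<in> incid \<Gamma>" "(p (Suc i mod q), l i) \<in> incid \<Gamma>" if "i < q" for i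
  proof -
    show "(p i, l i) \<in> incid \<Gamma>"
      using nb_walk_edge[OF h(1), of "2 * i"] that pts[OF that] adj_incid[OF geo]
      by (simp add: p_def l_def)
    have "(l i, p (Suc i mod q)) \<in> adj \<Gamma>"
      using nb_walk_edge[OF h(1), of "2 * i + 1"] that p_next[OF that] by (simp add: l_def)
    then show "(p (Suc i mod q), l i) \<in> incid \<Gamma>"
      using adj_incid[OF geo adj_sym] pts[of "Suc i mod q"] q by simp
  qed
  have "incid \<Delta> = (\<Union>i<q. {(p i, l i), (p (Suc i mod q), l i)})" (is "_ = ?R")
  proof (intro equalityI subsetI)
    fix e assume "e \<in> incid \<Delta>"
    then obtain i j where e: "e = (p i, l j)" "i < q" "j < q" "(p i, l j) \<in> incid \<Gamma>"
      by (auto simp: \<Delta>_def)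
    then have a: "(h (2 * i), h (2 * j + 1)) \<in> adj \<Gamma>" by (simp add: adj_def p_def l_def)
    \<comment> \<open>The outcome \<open>i = 0\<close>, \<open>Suc j = q\<close> of the chord lemma
      is the edge that closes up the walk; here it is hidden in the \<open>mod\<close>.\<close>
    have "i = j \<or> i = Suc j mod q"
    proof (cases "2 * i < 2 * j + 1")
      case True
      have "2 * j + 1 < 2 * q" using e(3) by simp
      from closed_nb_walk_chord[OF h(1) short True this adj_sym[OF a]]
      consider "2 * j + 1 = Suc (2 * i)" | "i = 0" "Suc j = q" by auto
      then show ?thesis by cases auto
    next
      case False
      then have lt: "2 * j + 1 < 2 * i" by presburger
      have "2 * i < 2 * q" using e(2) by simp
      from closed_nb_walk_chord[OF h(1) short lt this a] have "i = Suc j" by auto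
      then show ?thesis using e(2) by simp
    qed
    then show "e \<in> ?R" using e by auto
  next
    fix e assume "e \<in> ?R"
    then show "e \<in> incid \<Delta>" using edge q by (auto simp: \<Delta>_def)
  qed
  moreover have "bij_betw p {..<q} (points \<Delta>)"
    using inj unfolding \<Delta>_def p_def bij_betw_def inj_on_def by fastforce
  moreover have "bij_betw l {..<q} (lines \<Delta>)"
    using inj unfolding \<Delta>_def l_def bij_betw_def inj_on_def by fastforce
  ultimately have "ordinary_polygon q \<Delta>" unfolding ordinary_polygon_def by blast
  moreover have "subgeometry \<Delta> \<Gamma>"
    using pts lns by (auto simp: subgeometry_def \<Delta>_def)
  moreover have "elements \<Delta> = h ` {..<2 * q}"
  proof (intro equalityI subsetI)
    fix v assume "v \<in> elements \<Delta>"
    then show "v \<in> h ` {..<2 * q}" by (auto simp: elements_def \<Delta>_def p_def l_def)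
  next
    fix v assume "v \<in> h ` {..<2 * q}"
    then obtain i where i: "v = h i" "i < 2 * q" by auto
    show "v \<in> elements \<Delta>"
    proof (cases "even i")
      case True
      then have "v = p (i div 2)" "i div 2 < q" using i by (auto simp: p_def)
      then show ?thesis by (auto simp: elements_def \<Delta>_def)
    next
      case False
      then have "v = l (i div 2)" "i div 2 < q" using i by (auto simp: l_def)
      then show ?thesis by (auto simp: elements_def \<Delta>_def)
    qed
  qed
  ultimately show ?thesis by blast
qed

lemma closed_nb_walk_polygon:
  assumes geo: "geometry \<Gamma>" and h: "nb_walk (adj \<Gamma>) h (2 * q)" "h 0 = h (2 * q)" and q: "2 \<le> q"
    and short: "acyclic_below (adj \<Gamma>) (2 * q)"
  shows "\<exists>\<Delta>. subgeometry \<Delta> \<Gamma> \<and> ordinary_polygon q \<Delta> \<and> elements \<Delta> = h ` {..<2 * q}"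
proof (cases "h 0 \<in> points \<Gamma>")
  case True
  then show ?thesis using closed_nb_walk_polygon_at_point[OF geo h _ q short] by blast
next
  case False
  let ?h = "\<lambda>i. if i < 2 * q then h (Suc i) else h 1"
  have "3 \<le> 2 * q" using q by simp
  note rot = closed_nb_walk_rotate[OF h this short]
  have "?h 0 \<in> points \<Gamma>"
    using adj_points[OF geo nb_walk_edge[OF h(1), of 0]] False q by auto
  moreover have "?h 0 = ?h (2 * q)" using q by simp
  ultimately show ?thesis
    using closed_nb_walk_polygon_at_point[OF geo rot(1) _ _ q short] by (simp only: rot(2))
qed

text \<open>Unrolled to a periodic sequence, both arcs between two elements, including the one
  across the base point, become intervals of indices.\<close>

lemma ordinary_polygon_walk:
  assumes "ordinary_polygon k \<Delta>" "subgeometry \<Delta> \<Gamma>" "2 \<le> k"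
  shows "\<exists>h. (\<forall>i. (h i, h (Suc i)) \<in> adj \<Gamma>) \<and> (\<forall>i. h i \<noteq> h (Suc (Suc i))) \<and>
    (\<forall>i. h (i + 2 * k) = h i) \<and> elements \<Delta> \<subseteq> h ` {..<2 * k}"
proof -
  obtain p l where p: "bij_betw p {..<k} (points \<Delta>)" and l: "bij_betw l {..<k} (lines \<Delta>)"
    and inc: "incid \<Delta> = (\<Union>i<k. {(p i, l i), (p (Suc i mod k), l i)})"
    using assms(1) unfolding ordinary_polygon_def by blast
  define h where "h i = (if even i then p (i div 2 mod k) else l (i div 2 mod k))" for i
  have inc': "(p (i mod k), l (i mod k)) \<in> incid \<Gamma>" "(p (Suc i mod k), l (i mod k)) \<in> incid \<Gamma>" for i
  proof -
    have "i mod k < k" using assms(3) by simp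
    then have "(p (i mod k), l (i mod k)) \<in> incid \<Delta>" "(p (Suc (i mod k) mod k), l (i mod k)) \<in> incid \<Delta>"
      unfolding inc by blast+
    then show "(p (i mod k), l (i mod k)) \<in> incid \<Gamma>" "(p (Suc i mod k), l (i mod k)) \<in> incid \<Gamma>"
      using assms(2) by (auto simp: subgeometry_def mod_Suc_eq)
  qed
  have neq: "i mod k \<noteq> Suc i mod k" for i
    using assms(3) by (simp add: mod_Suc)
  show ?thesis
  proof (intro exI[of _ h] conjI allI)
    fix i
    show "(h i, h (Suc i)) \<in> adj \<Gamma>"
      using inc'[of "i div 2"] by (auto simp: h_def adj_def)
    have "p (i div 2 mod k) \<noteq> p (Suc (i div 2) mod k)" "l (i div 2 mod k) \<noteq> l (Suc (i div 2) mod k)"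
      using neq[of "i div 2"] assms(3) p l
      by (auto simp: bij_betw_def dest!: inj_onD)
    then show "h i \<noteq> h (Suc (Suc i))" by (auto simp: h_def)
    show "h (i + 2 * k) = h i" by (auto simp: h_def)
  next
    show "elements \<Delta> \<subseteq> h ` {..<2 * k}"
    proof
      fix v assume "v \<in> elements \<Delta>"
      then consider "v \<in> points \<Delta>" | "v \<in> lines \<Delta>" by (auto simp: elements_def)
      then show "v \<in> h ` {..<2 * k}"
      proof cases
        case 1
        then obtain i where "i < k" "v = p i" using p by (auto simp: bij_betw_def)
        then show ?thesis by (intro image_eqI[of _ _ "2 * i"]) (auto simp: h_def)
      next
        case 2
        then obtain i where "i < k" "v = l i" using l by (auto simp: bij_betw_def)
        then show ?thesis by (intro image_eqI[of _ _ "2 * i + 1"]) (auto simp: h_def)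
      qed
    qed
  qed
qed

section \<open>Girth, diameter and metric of a generalised 2n-gon\<close>

locale even_polygon =
  fixes \<Gamma> :: "'a geometry" and n :: nat
  assumes two_le: "2 \<le> n" and gp: "generalised_polygon (2 * n) \<Gamma>"
begin

abbreviation "E \<equiv> adj \<Gamma>"
abbreviation "V \<equiv> elements \<Gamma>"

text \<open>Nothing is lost on \<open>V\<close>, where distances are finite by
  \<open>inc_dist_attained\<close>.\<close>

definition d :: "'a \<Rightarrow> 'a \<Rightarrow> nat" where
  "d x y = the_enat (inc_dist \<Gamma> x y)"

lemma geo: "geometry \<Gamma>"
  using gp by (simp add: generalised_polygon_def)

lemma E_in_V: "(x, y) \<in> E \<Longrightarrow> x \<in> V" "(x, y) \<in> E \<Longrightarrow> y \<in> V"
  using adj_elements[OF geo] by blast+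

text \<open>A shortest closed walk is an ordinary \<open>q\<close>-gon. Its length is even since
  points and lines alternate, and length \<open>2\<close> would be a backtrack, so
  \<open>2 \<le> q\<close>; but \<open>q < 2 * n\<close> is excluded by the axioms.\<close>

lemma girth: "acyclic_below E (4 * n)"
proof (rule ccontr)
  define P where "P L \<longleftrightarrow> (\<exists>f. 0 < L \<and> nb_walk E f L \<and> f 0 = f L)" for L
  assume "\<not> ?thesis"
  then obtain L0 where L0: "P L0" "L0 < 4 * n" by (auto simp: acyclic_below_def P_def)
  define L where "L = (LEAST L. P L)"
  have "P L" unfolding L_def using L0(1) by (rule LeastI)
  then obtain f where f: "0 < L" "nb_walk E f L" "f 0 = f L" by (auto simp: P_def)
  have "L < 4 * n" using L0 Least_le[of P L0] by (simp add: L_def)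
  have short: "acyclic_below E L"
    unfolding acyclic_below_def using not_less_Least[of _ P] by (auto simp: L_def P_def)
  have "even L" using nb_walk_parity[OF geo f(2), of L] f(3) by auto
  then obtain q where q: "L = 2 * q" by blast
  have "L \<noteq> 2"
    using f nb_walk_turn[OF f(2), of 0] by (auto simp: numeral_2_eq_2)
  then have "2 \<le> q" using q f(1) by auto
  then obtain \<Delta> where "subgeometry \<Delta> \<Gamma>" "ordinary_polygon q \<Delta>"
    using closed_nb_walk_polygon[OF geo, of f q] f short unfolding q by blast
  moreover have "q < 2 * n" using \<open>L < 4 * n\<close> q by simp
  ultimately show False using gp \<open>2 \<le> q\<close> unfolding generalised_polygon_def by blast
qed

lemma nb_walk_in_V:
  assumes "nb_walk E f k" "f 0 \<in> V" "i \<le> k"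
  shows "f i \<in> V"
  using assms nb_walk_edge[OF assms(1), of "i - 1"] E_in_V(2) by (cases i) auto

text \<open>Common first steps are stripped by induction. Walks that part at once give a closed
  walk, \<open>f\<close> backwards and then \<open>g\<close>, of length \<open>a + b\<close> below
  the girth. The turn at the shared start is sound as the first steps differ;
  \<open>acyclic_below\<close> asks nothing of the turn at the shared end.\<close>

lemma nb_walk_unique:
  assumes "nb_walk E f a" "nb_walk E g b" "f 0 = g 0" "f a = g b" "a + b < 4 * n"
  shows "a = b \<and> (\<forall>i\<le>a. f i = g i)"
  using assms
proof (induction a arbitrary: b f g)
  case 0
  then show ?case using acyclic_belowD[OF girth, of b g] by (cases b) auto
next
  case (Suc a)
  show ?case
  proof (cases b)
    case 0
    then show ?thesis using Suc.prems acyclic_belowD[OF girth, of "Suc a" f] by auto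
  next
    case b: (Suc b')
    show ?thesis
    proof (cases "f 1 = g 1")
      case True
      have "nb_walk E (\<lambda>i. f (1 + i)) a" "nb_walk E (\<lambda>i. g (1 + i)) b'"
        using nb_walk_shift[OF Suc.prems(1), of 1 a] nb_walk_shift[OF Suc.prems(2), of 1 b'] b
        by simp_all
      then have IH: "a = b' \<and> (\<forall>i\<le>a. f (1 + i) = g (1 + i))"
        using True Suc.prems b by (intro Suc.IH) auto
      have "f i = g i" if "i \<le> Suc a" for i
        using that IH Suc.prems(3) by (cases i) auto
      then show ?thesis using IH b by auto
    next
      case False
      let ?h = "glue (Suc a) (\<lambda>i. f (Suc a - i)) g"
      have "nb_walk E ?h (Suc a + b)"
        using Suc.prems False by (intro nb_walk_glue nb_walk_rev sym_adj) auto
      moreover have "?h 0 = ?h (Suc a + b)"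
        using Suc.prems by (subst glue_add) auto
      ultimately show ?thesis
        using acyclic_belowD[OF girth, of "Suc a + b" ?h] Suc.prems(5) by simp
    qed
  qed
qed

text \<open>Apartments are the ordinary 2n-gons of \<open>\<Gamma>\<close>, here as sequences of
  period \<open>4 * n\<close>.\<close>

lemma apartment:
  assumes "x \<in> V" "y \<in> V"
  obtains h i j where "\<And>i. (h i, h (Suc i)) \<in> E" "\<And>i. h i \<noteq> h (Suc (Suc i))"
    "\<And>i. h (i + 4 * n) = h i" "x = h i" "y = h j" "i < 4 * n" "j < 4 * n"
proof -
  obtain \<Delta> where \<Delta>: "subgeometry \<Delta> \<Gamma>" "ordinary_polygon (2 * n) \<Delta>" "x \<in> elements \<Delta>" "y \<in> elements \<Delta>"
    using gp assms unfolding generalised_polygon_def by blast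
  have k: "2 \<le> 2 * n" using two_le by simp
  obtain h where h: "\<And>i. (h i, h (Suc i)) \<in> E" "\<And>i. h i \<noteq> h (Suc (Suc i))"
    "\<And>i. h (i + 2 * (2 * n)) = h i" "elements \<Delta> \<subseteq> h ` {..<2 * (2 * n)}"
    using ordinary_polygon_walk[OF \<Delta>(2,1) k] by blast
  have "x \<in> h ` {..<4 * n}" "y \<in> h ` {..<4 * n}" using h(4) \<Delta>(3,4) by auto
  then obtain i j where "x = h i" "y = h j" "i < 4 * n" "j < 4 * n" by auto
  with h(1-3) show ?thesis by (intro that[of h i j]) simp_all
qed

lemma element_nbrs:
  assumes "x \<in> V"
  shows "\<exists>a\<in>V. \<exists>b\<in>V. a \<noteq> b \<and> (x, a) \<in> E \<and> (x, b) \<in> E"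
proof -
  obtain h i where h: "\<And>i. (h i, h (Suc i)) \<in> E" "\<And>i. h i \<noteq> h (Suc (Suc i))"
    "\<And>i. h (i + 4 * n) = h i" "x = h i"
    using apartment[OF assms assms] by metis
  \<comment> \<open>The index before \<open>i\<close>, raised by one period because \<open>i\<close>
    may be \<open>0\<close>.\<close>
  define j where "j = i + 4 * n - 1"
  have j: "Suc j = i + 4 * n" using two_le by (simp add: j_def)
  then have "h (Suc j) = x" using h(3,4) by simp
  then have "(x, h j) \<in> E" "(x, h (Suc (Suc j))) \<in> E" "h j \<noteq> h (Suc (Suc j))"
    using h(1)[of j] h(1)[of "Suc j"] h(2)[of j] adj_sym by auto
  then show ?thesis using E_in_V(2) by blast
qed

lemma relpow_E_sym: "(x, y) \<in> E ^^ k \<Longrightarrow> (y, x) \<in> E ^^ k"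
proof (induction k arbitrary: y)
  case (Suc k)
  from Suc.prems obtain z where z: "(x, z) \<in> E ^^ k" "(z, y) \<in> E" by (rule relpow_Suc_E)
  show ?case by (rule relpow_Suc_I2[OF adj_sym[OF z(2)] Suc.IH[OF z(1)]])
qed auto

text \<open>The two arcs of an apartment between its two elements have total length
  \<open>4 * n\<close>, so one has length at most \<open>2 * n\<close>.\<close>

lemma diameter:
  assumes "x \<in> V" "y \<in> V"
  shows "\<exists>k\<le>2 * n. (x, y) \<in> E ^^ k"
proof -
  obtain h i j where h: "\<And>i. (h i, h (Suc i)) \<in> E" "\<And>i. h (i + 4 * n) = h i"
    and ij: "x = h i" "y = h j" "i < 4 * n" "j < 4 * n"
    using apartment[OF assms] by metis
  have walk: "(h i, h (i + k)) \<in> E ^^ k" for i k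
    unfolding relpow_fun_conv using h(1) by (intro exI[of _ "\<lambda>m. h (i + m)"]) auto
  have *: "\<exists>k\<le>2 * n. (h i, h j) \<in> E ^^ k" if "i \<le> j" "j < 4 * n" for i j
  proof (cases "j - i \<le> 2 * n")
    case True
    then show ?thesis using walk[of i "j - i"] that by auto
  next
    case False
    have "(h j, h i) \<in> E ^^ (i + 4 * n - j)"
      using walk[of j "i + 4 * n - j"] that h(2) by simp
    then show ?thesis using relpow_E_sym False that by (intro exI[of _ "i + 4 * n - j"]) auto
  qed
  show ?thesis
  proof (cases "i \<le> j")
    case True
    then show ?thesis using * ij by simp
  next
    case False
    then show ?thesis using *[of j i] ij relpow_E_sym by auto
  qed
qed

lemma inc_dist_attained:
  assumes "x \<in> V" "y \<in> V"
  shows "\<exists>k\<le>2 * n. \<exists>f. nb_walk E f k \<and> f 0 = x \<and> f k = y \<and> inc_dist \<Gamma> x y = enat k"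
proof -
  define k where "k = (LEAST k. (x, y) \<in> E ^^ k)"
  obtain k0 where k0: "k0 \<le> 2 * n" "(x, y) \<in> E ^^ k0" using diameter[OF assms] by blast
  have k: "(x, y) \<in> E ^^ k" unfolding k_def using k0(2) by (rule LeastI)
  have min: "k \<le> j" if "(x, y) \<in> E ^^ j" for j unfolding k_def using that by (rule Least_le)
  have "inc_dist \<Gamma> x y = enat k"
    unfolding inc_dist_def adj_def[symmetric]
  proof (rule antisym)
    show "(INF k\<in>{k. (x, y) \<in> E ^^ k}. enat k) \<le> enat k" using k by (intro INF_lower) simp
    show "enat k \<le> (INF k\<in>{k. (x, y) \<in> E ^^ k}. enat k)" using min by (intro INF_greatest) simp
  qed
  then show ?thesis using shortest_walk_nb[OF k min] min[OF k0(2)] k0(1) by (metis le_trans)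
qed

lemma inc_dist_eq: "x \<in> V \<Longrightarrow> y \<in> V \<Longrightarrow> inc_dist \<Gamma> x y = enat (d x y)"
  using inc_dist_attained[of x y] by (auto simp: d_def)

lemma d_le: "x \<in> V \<Longrightarrow> y \<in> V \<Longrightarrow> d x y \<le> 2 * n"
  using inc_dist_attained[of x y] by (auto simp: d_def)

lemma geodesic:
  assumes "x \<in> V" "y \<in> V"
  obtains f where "nb_walk E f (d x y)" "f 0 = x" "f (d x y) = y"
proof -
  obtain k f where f: "nb_walk E f k" "f 0 = x" "f k = y" "inc_dist \<Gamma> x y = enat k"
    using inc_dist_attained[OF assms] by blast
  then have "d x y = k" by (simp add: d_def)
  with f(1-3) show ?thesis by (intro that[of f]) simp_all
qed

text \<open>The walk and a geodesic with the same ends coincide if their total length is below the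
  girth. For \<open>L\<close> above \<open>2 * n\<close> the second alternative bounds the distance
  from below.\<close>

lemma d_nb_long:
  assumes "nb_walk E f L" "f 0 = x" "f L = y" "x \<in> V"
  shows "d x y = L \<or> 4 * n \<le> L + d x y"
proof -
  have "y \<in> V" using nb_walk_in_V[OF assms(1), of L] assms by simp
  obtain g where g: "nb_walk E g (d x y)" "g 0 = x" "g (d x y) = y"
    by (rule geodesic[OF assms(4) \<open>y \<in> V\<close>])
  have "L = d x y" if "L + d x y < 4 * n"
    using nb_walk_unique[OF assms(1) g(1) trans[OF assms(2) g(2)[symmetric]]
        trans[OF assms(3) g(3)[symmetric]] that] by (rule conjunct1)
  then show ?thesis by linarith
qed

text \<open>The second alternative of \<open>d_nb_long\<close> leaves only
  \<open>k = d x y = 2 * n\<close>.\<close>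

lemma d_nbI:
  assumes "nb_walk E f k" "f 0 = x" "f k = y" "x \<in> V" "k \<le> 2 * n"
  shows "d x y = k"
proof -
  have "y \<in> V" using nb_walk_in_V[OF assms(1), of k] assms by simp
  from d_nb_long[OF assms(1-4)] assms(5) d_le[OF assms(4) this] show ?thesis by linarith
qed

lemma d_self [simp]: "x \<in> V \<Longrightarrow> d x x = 0"
  by (rule d_nbI[of "\<lambda>_. x" 0]) simp_all

lemma d_eq_0:
  assumes "x \<in> V" "y \<in> V" "d x y = 0"
  shows "x = y"
proof -
  obtain f where f: "nb_walk E f (d x y)" "f 0 = x" "f (d x y) = y"
    by (rule geodesic[OF assms(1,2)])
  show ?thesis using f(2) f(3)[unfolded assms(3)] by (rule subst)
qed

lemma d_sym:
  assumes "x \<in> V" "y \<in> V"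
  shows "d x y = d y x"
proof -
  obtain f where f: "nb_walk E f (d x y)" "f 0 = x" "f (d x y) = y" by (rule geodesic[OF assms])
  have "d y x = d x y"
    using d_le[OF assms] assms(2) f(2,3)
    by (intro d_nbI[OF nb_walk_rev[OF sym_adj f(1)]]) simp_all
  then show ?thesis by (rule sym)
qed

lemma d_le_relpow:
  assumes "x \<in> V" "y \<in> V" "(x, y) \<in> E ^^ k"
  shows "d x y \<le> k"
proof -
  have "inc_dist \<Gamma> x y \<le> enat k"
    unfolding inc_dist_def adj_def[symmetric] using assms(3) by (intro INF_lower) simp
  then show ?thesis using inc_dist_eq[OF assms(1,2)] by simp
qed

lemma d_triangle:
  assumes "x \<in> V" "y \<in> V" "z \<in> V"
  shows "d x z \<le> d x y + d y z"
proof (rule d_le_relpow[OF assms(1,3)])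
  have "(a, b) \<in> E ^^ d a b" if ab: "a \<in> V" "b \<in> V" for a b
  proof -
    obtain f where f: "nb_walk E f (d a b)" "f 0 = a" "f (d a b) = b" by (rule geodesic[OF ab])
    show ?thesis using nb_walk_relpow[OF f(1)] unfolding f(2,3) .
  qed
  then show "(x, z) \<in> E ^^ (d x y + d y z)"
    unfolding relpow_add using assms by (intro relcompI[of x y]) simp_all
qed

lemma d_parity:
  assumes "x \<in> V" "y \<in> V"
  shows "y \<in> points \<Gamma> \<longleftrightarrow> (x \<in> points \<Gamma> \<longleftrightarrow> even (d x y))"
proof -
  obtain f where "nb_walk E f (d x y)" "f 0 = x" "f (d x y) = y"
    by (rule geodesic[OF assms])
  then show ?thesis using nb_walk_parity[OF geo, of f "d x y" "d x y"] by simp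
qed

text \<open>Take \<open>y\<close> in \<open>T\<close> farthest from \<open>x\<close>. If a geodesic
  to \<open>y\<close> were shorter than \<open>2 * n\<close>, a neighbour of \<open>y\<close> in
  \<open>T\<close> off that geodesic would be farther away.\<close>

lemma exists_opposite:
  assumes "x \<in> V" "T \<subseteq> V" "T \<noteq> {}"
    and T: "\<And>v. v \<in> T \<Longrightarrow> \<exists>a\<in>T. \<exists>b\<in>T. a \<noteq> b \<and> (v, a) \<in> E \<and> (v, b) \<in> E"
  shows "\<exists>y\<in>T. d x y = 2 * n"
proof -
  obtain y0 where "y0 \<in> T" using assms(3) by blast
  moreover have "\<forall>y. y \<in> T \<longrightarrow> d x y < Suc (2 * n)"
    using d_le[OF assms(1)] assms(2) unfolding less_Suc_eq_le by blast
  ultimately have "\<exists>y. y \<in> T \<and> (\<forall>z. z \<in> T \<longrightarrow> d x z \<le> d x y)"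
    by (rule ex_has_greatest_nat[of "\<lambda>y. y \<in> T"])
  then obtain y where y: "y \<in> T" "\<And>z. z \<in> T \<Longrightarrow> d x z \<le> d x y" by blast
  have "y \<in> V" using y(1) assms(2) by blast
  obtain f where f: "nb_walk E f (d x y)" "f 0 = x" "f (d x y) = y"
    by (rule geodesic[OF assms(1) \<open>y \<in> V\<close>])
  from T[OF y(1)] obtain a b where ab: "a \<in> T" "b \<in> T" "a \<noteq> b" "(y, a) \<in> E" "(y, b) \<in> E" by blast
  obtain z where z: "z \<in> T" "(y, z) \<in> E" "z \<noteq> f (d x y - 1)"
    by (cases "a = f (d x y - 1)") (use ab in auto)
  have "d x y = 2 * n"
  proof (rule ccontr)
    assume "d x y \<noteq> 2 * n"
    then have "Suc (d x y) \<le> 2 * n" using d_le[OF assms(1) \<open>y \<in> V\<close>] by simp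
    moreover have "nb_walk E (f(Suc (d x y) := z)) (Suc (d x y))"
      using f z by (intro nb_walk_snoc) auto
    ultimately have "d x z = Suc (d x y)"
      using f assms(1) by (intro d_nbI[of "f(Suc (d x y) := z)"]) auto
    then show False using y(2)[OF z(1)] by simp
  qed
  then show ?thesis using y(1) by blast
qed

end

section \<open>Convexity of ovoidal subspaces and the case of a distance ovoid\<close>

locale ovoidal = even_polygon +
  fixes S :: "'a set"
  assumes ov: "ovoidal_subspace n \<Gamma> S"
begin

lemma S_V: "x \<in> S \<Longrightarrow> x \<in> V"
  using ov unfolding ovoidal_subspace_def subspace_def by (elim conjE) (rule subsetD)

lemma covering:
  assumes "x \<in> V"
  obtains y where "y \<in> S" "d x y \<le> n"
proof -
  obtain y where "y \<in> S" "inc_dist \<Gamma> x y \<le> enat n"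
    using ov assms unfolding ovoidal_subspace_def by blast
  then show ?thesis using that inc_dist_eq[OF assms S_V] by simp
qed

lemma nearest_unique:
  assumes "x \<in> V" "y \<in> S" "d x y < n" "z \<in> S" "z' \<in> S"
    and "\<And>w. w \<in> S \<Longrightarrow> d x z \<le> d x w" "\<And>w. w \<in> S \<Longrightarrow> d x z' \<le> d x w"
  shows "z = z'"
proof -
  have eq: "inc_dist \<Gamma> x w = enat (d x w)" if "w \<in> S" for w
    using inc_dist_eq[OF assms(1) S_V[OF that]] .
  have "inc_dist \<Gamma> x y < enat n" using assms(3) eq[OF assms(2)] by simp
  then have "\<exists>!z. z \<in> S \<and> (\<forall>w\<in>S. inc_dist \<Gamma> x z \<le> inc_dist \<Gamma> x w)"
    using ov assms(1,2) unfolding ovoidal_subspace_def by blast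
  moreover have "\<forall>w\<in>S. inc_dist \<Gamma> x z \<le> inc_dist \<Gamma> x w"
    using assms(4,6) eq by simp
  moreover have "\<forall>w\<in>S. inc_dist \<Gamma> x z' \<le> inc_dist \<Gamma> x w"
    using assms(5,7) eq by simp
  ultimately show ?thesis using assms(4,5) by blast
qed

lemma line_nbr:
  assumes "x \<in> S" "x \<notin> points \<Gamma>" "(x, y) \<in> E"
  shows "y \<in> S"
proof -
  have "y \<in> points \<Gamma>" using adj_points[OF geo assms(3)] assms(2) by blast
  then have "(y, x) \<in> incid \<Gamma>" using adj_incid[OF geo adj_sym[OF assms(3)]] by blast
  moreover have "x \<in> S \<inter> lines \<Gamma>" using S_V[OF assms(1)] assms(1,2) by (auto simp: elements_def)
  moreover have "\<forall>L \<in> S \<inter> lines \<Gamma>. \<forall>x \<in> points \<Gamma>. (x, L) \<in> incid \<Gamma> \<longrightarrow> x \<in> S"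
    using ov unfolding ovoidal_subspace_def subspace_def by (elim conjE)
  ultimately show ?thesis using \<open>y \<in> points \<Gamma>\<close> by blast
qed

text \<open>
  The midpoint of a geodesic of length \<open>2 * c < 2 * n\<close> between elements of \<open>S\<close> is at
  distance less than \<open>n\<close> from \<open>S\<close>, so by uniqueness of nearest elements neither end is
  nearest to it. Rerouting one half of the geodesic to the nearest element gives a shorter
  geodesic between elements of \<open>S\<close>.
\<close>

lemma convex:
  assumes "nb_walk E f k" "f 0 \<in> S" "f k \<in> S" "k < 2 * n" "i \<le> k"
  shows "f i \<in> S"
  using assms
proof (induction k arbitrary: f i rule: less_induct)
  case (less k)
  \<comment> \<open>One inner element in \<open>S\<close> is enough: the induction hypothesis
    applies to the pieces before and after it.\<close>
  have split: "f i \<in> S" if m: "0 < m" "m < k" "f m \<in> S" for m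
  proof (cases "i \<le> m")
    case True
    show ?thesis
      using nb_walk_le[OF less.prems(1), of m] less.prems m True
      by (intro less.IH[of m f i]) auto
  next
    case False
    have "nb_walk E (\<lambda>j. f (m + j)) (k - m)"
      using less.prems(1) m by (intro nb_walk_shift) auto
    then have "f (m + (i - m)) \<in> S"
      using less.prems m False by (intro less.IH[of "k - m" "\<lambda>j. f (m + j)" "i - m"]) auto
    then show ?thesis using False by simp
  qed
  show ?case
  proof (cases "k \<le> 1")
    case True
    then have "i = 0 \<or> i = k" using less.prems(5) by linarith
    then show ?thesis using less.prems(2,3) by blast
  next
    case k: False
    have last: "(f k, f (k - 1)) \<in> E"
      using nb_walk_edge[OF less.prems(1), of "k - 1"] k adj_sym by simp
    have first: "(f 0, f 1) \<in> E"
      using nb_walk_edge[OF less.prems(1), of 0] k by simp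
    show ?thesis
    proof (cases "f 0 \<in> points \<Gamma> \<and> f k \<in> points \<Gamma>")
      case False
      \<comment> \<open>A line in \<open>S\<close> has all its points in \<open>S\<close>, so its
        neighbour on the walk is an inner element in \<open>S\<close>.\<close>
      then have "f 1 \<in> S \<or> f (k - 1) \<in> S"
        using line_nbr[OF less.prems(2) _ first] line_nbr[OF less.prems(3) _ last] by blast
      then show ?thesis using split[of 1] split[of "k - 1"] k by auto
    next
      case pts: True
      then have "even k" using nb_walk_parity[OF geo less.prems(1), of k] by auto
      then obtain c where c: "k = 2 * c" by blast
      then have c_pos: "0 < c" "c < n" using k less.prems(4) by auto
      have f0: "f 0 \<in> V" using S_V less.prems(2) .
      have m: "f c \<in> V" using nb_walk_in_V[OF less.prems(1) f0, of c] c by simp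
      have rev: "nb_walk E (\<lambda>j. f (k - j)) k" by (rule nb_walk_rev[OF sym_adj less.prems(1)])
      have d0: "d (f c) (f 0) = c"
        using c c_pos m by (intro d_nbI[OF nb_walk_shift[OF rev, of c c]]) auto
      have dk: "d (f c) (f k) = c"
        using c c_pos m by (intro d_nbI[OF nb_walk_shift[OF less.prems(1), of c c]]) (auto simp: mult_2)
      have "\<exists>z. z \<in> S \<and> (\<forall>w. w \<in> S \<longrightarrow> d (f c) z \<le> d (f c) w)"
        using less.prems(2) by (rule ex_has_least_nat)
      then obtain z where z: "z \<in> S" "\<And>w. w \<in> S \<Longrightarrow> d (f c) z \<le> d (f c) w" by blast
      have "d (f c) z \<noteq> c"
      proof
        assume eq: "d (f c) z = c"
        have "f 0 = f k"
        proof (rule nearest_unique[OF m less.prems(2) _ less.prems(2,3)])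
          show "d (f c) (f 0) < n" using d0 c_pos by simp
          show "d (f c) (f 0) \<le> d (f c) w" if "w \<in> S" for w using z(2)[OF that] d0 eq by simp
          show "d (f c) (f k) \<le> d (f c) w" if "w \<in> S" for w using z(2)[OF that] dk eq by simp
        qed
        moreover have "d (f 0) (f k) = k"
          using less.prems(1,4) f0 by (intro d_nbI[of f]) auto
        ultimately show False using d_self[OF f0] k by simp
      qed
      then have lt: "d (f c) z < c" using z(2)[OF less.prems(2)] d0 by simp
      define j where "j = d (f c) z"
      obtain g where g: "nb_walk E g j" "g 0 = f c" "g j = z"
        unfolding j_def by (rule geodesic[OF m S_V[OF z(1)]])
      have reroute: "h 1 \<in> S"
        if h: "nb_walk E h k" "h 0 \<in> S" "h c = f c" "0 < j \<longrightarrow> h (c - 1) \<noteq> g 1" for h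
      proof -
        have "nb_walk E (glue c h g) (c + j)"
          using nb_walk_le[OF h(1), of c] h(3,4) g c by (intro nb_walk_glue) auto
        moreover have "glue c h g 0 \<in> S" using h(2) by simp
        moreover have "glue c h g (c + j) \<in> S"
          using h(3) g(2,3) z(1) by (subst glue_add) simp_all
        moreover have "c + j < k" using lt c unfolding j_def by simp
        ultimately have "glue c h g 1 \<in> S"
          using c_pos less.prems(4) by (intro less.IH[of "c + j" "glue c h g" 1]) simp_all
        then show ?thesis using c_pos by simp
      qed
      have "f (c - 1) \<noteq> f (Suc c)"
        using nb_walk_turn[OF less.prems(1), of "c - 1"] c c_pos by simp
      \<comment> \<open>At most one half of the walk, seen from the middle, starts along
        \<open>g\<close>; the other half continues into \<open>g\<close> without
        backtracking.\<close>
      then consider "f (c - 1) \<noteq> g 1" | "f (Suc c) \<noteq> g 1" by metis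
      then show ?thesis
      proof cases
        case 1
        then have "f 1 \<in> S" using less.prems(1,2) by (intro reroute[of f]) auto
        then show ?thesis using split[of 1] k by auto
      next
        case 2
        have "k - (c - 1) = Suc c" "k - c = c" using c c_pos by simp_all
        then have "f (k - 1) \<in> S"
          using 2 rev less.prems(3) reroute[of "\<lambda>j. f (k - j)"] by simp
        then show ?thesis using split[of "k - 1"] k by auto
      qed
    qed
  qed
qed

lemma geodesic_in_S:
  assumes "x \<in> S" "y \<in> S" "d x y < 2 * n"
  obtains f where "nb_walk E f (d x y)" "f 0 = x" "f (d x y) = y" "\<forall>i\<le>d x y. f i \<in> S"
proof -
  obtain f where f: "nb_walk E f (d x y)" "f 0 = x" "f (d x y) = y"
    by (rule geodesic[OF S_V[OF assms(1)] S_V[OF assms(2)]])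
  have "f i \<in> S" if "i \<le> d x y" for i
    using convex[OF f(1) _ _ assms(3) that] f(2,3) assms(1,2) by simp
  then show ?thesis by (intro that[OF f]) blast
qed

text \<open>Two distinct points closer than \<open>2 * n\<close> would be joined by a geodesic
  inside \<open>S\<close>, whose second element is a line.\<close>

lemma point_set_distance_ovoid:
  assumes "S \<subseteq> points \<Gamma>"
  shows "distance_ovoid n \<Gamma> S"
proof -
  have "d x y = 2 * n" if xy: "x \<in> S" "y \<in> S" "x \<noteq> y" for x y
  proof (rule ccontr)
    assume "d x y \<noteq> 2 * n"
    then have "d x y < 2 * n" using d_le[OF S_V S_V] xy by (simp add: le_neq_implies_less)
    then obtain f where f: "nb_walk E f (d x y)" "f 0 = x" "f (d x y) = y" "\<forall>i\<le>d x y. f i \<in> S"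
      by (rule geodesic_in_S[OF xy(1,2)])
    have pos: "0 < d x y" using d_eq_0[OF S_V S_V] xy by blast
    then have "(f 0, f 1) \<in> E" using nb_walk_edge[OF f(1), of 0] by simp
    moreover have "f 0 \<in> points \<Gamma>" "f 1 \<in> points \<Gamma>" using f(4) pos assms by auto
    ultimately show False using adj_points[OF geo] by blast
  qed
  then show ?thesis
    using assms ov inc_dist_eq[OF S_V S_V]
    unfolding distance_ovoid_def ovoidal_subspace_def opposite_def by simp
qed

section \<open>Subspaces containing an apartment\<close>

text \<open>By \<open>girth\<close> and \<open>closed_nb_walk_polygon\<close> such a walk traces an
  ordinary 2n-gon inside \<open>S\<close>; the walk form suits gluing.\<close>

definition contains_apartment :: bool where
  "contains_apartment \<longleftrightarrow>
     (\<exists>h. nb_walk E h (4 * n) \<and> h 0 = h (4 * n) \<and> (\<forall>i\<le>4 * n. h i \<in> S))"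

text \<open>Convexity stops short of length \<open>2 * n\<close>. It is applied to \<open>a\<close>
  and \<open>y\<close>, at distance \<open>2 * n - 1\<close> by parity and the triangle inequality,
  and \<open>x\<close> is put in front.\<close>

lemma opposite_path:
  assumes "x \<in> S" "y \<in> S" "d x y = 2 * n" "a \<in> S" "(x, a) \<in> E"
  obtains f where "nb_walk E f (2 * n)" "f 0 = x" "f 1 = a" "f (2 * n) = y"
    "\<forall>i\<le>2 * n. f i \<in> S"
proof -
  have V: "x \<in> V" "y \<in> V" "a \<in> V" using assms S_V by blast+
  have "d x a \<le> 1" using assms(5) V by (intro d_le_relpow) auto
  then have "2 * n \<le> 1 + d a y" using d_triangle[OF V(1,3,2)] assms(3) by linarith
  moreover have "d a y \<noteq> 2 * n"
    using d_parity[OF V(1,2)] d_parity[OF V(3,2)] adj_points[OF geo assms(5)] assms(3) by auto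
  ultimately have day: "Suc (d a y) = 2 * n" using d_le[OF V(3,2)] by linarith
  then have "d a y < 2 * n" by simp
  then obtain g where g: "nb_walk E g (d a y)" "g 0 = a" "g (d a y) = y" "\<forall>i\<le>d a y. g i \<in> S"
    by (rule geodesic_in_S[OF assms(4,2)])
  \<comment> \<open>Otherwise the rest of \<open>g\<close> would join \<open>x\<close> to
    \<open>y\<close> in \<open>2 * n - 2\<close> steps.\<close>
  have "x \<noteq> g 1" if "0 < d a y"
  proof
    assume "x = g 1"
    then have "d x y = d a y - 1"
      using that g(3) V(1) day by (intro d_nbI[OF nb_walk_shift[OF g(1), of 1]]) auto
    then show False using assms(3) day by simp
  qed
  then have "nb_walk E (case_nat x g) (Suc (d a y))"
    using g(1,2) assms(5) by (intro nb_walk_Cons) auto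
  then have walk: "nb_walk E (case_nat x g) (2 * n)" unfolding day .
  have last: "case_nat x g (2 * n) = y" using g(3) by (simp add: day[symmetric])
  have "case_nat x g i \<in> S" if "i \<le> 2 * n" for i
    using that g(4) assms(1) unfolding day[symmetric] by (cases i) auto
  then show ?thesis using g(2) by (intro that[OF walk _ _ last]) auto
qed

text \<open>Paths from \<open>x\<close> to \<open>y\<close> through \<open>a\<close> and through
  \<open>b\<close> are followed out and back. They enter \<open>y\<close> from different neighbours:
  otherwise their parts before \<open>y\<close>, of total length \<open>4 * n - 2\<close>, would
  coincide.\<close>

lemma opposite_closed_walk:
  assumes "x \<in> S" "y \<in> S" "d x y = 2 * n"
    and "a \<in> S" "b \<in> S" "a \<noteq> b" "(x, a) \<in> E" "(x, b) \<in> E"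
  obtains h where "nb_walk E h (4 * n)" "h 0 = x" "h (4 * n) = x" "h (2 * n) = y"
    "\<forall>i\<le>4 * n. h i \<in> S"
proof -
  obtain f where f: "nb_walk E f (2 * n)" "f 0 = x" "f 1 = a" "f (2 * n) = y"
    "\<forall>i\<le>2 * n. f i \<in> S" by (rule opposite_path[OF assms(1-4,7)])
  obtain g where g: "nb_walk E g (2 * n)" "g 0 = x" "g 1 = b" "g (2 * n) = y"
    "\<forall>i\<le>2 * n. g i \<in> S" by (rule opposite_path[OF assms(1-3,5,8)])
  have "f (2 * n - 1) \<noteq> g (2 * n - 1)"
  proof
    assume eq: "f (2 * n - 1) = g (2 * n - 1)"
    have "f 0 = g 0" using f(2) g(2) by simp
    moreover have "2 * n - 1 + (2 * n - 1) < 4 * n" using two_le by simp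
    ultimately have "\<forall>i\<le>2 * n - 1. f i = g i"
      using nb_walk_unique[OF nb_walk_le[OF f(1)] nb_walk_le[OF g(1)] _ eq] by simp
    then have "f 1 = g 1" using two_le by simp
    then show False using f(3) g(3) assms(6) by simp
  qed
  then have walk: "nb_walk E (glue (2 * n) f (\<lambda>i. g (2 * n - i))) (2 * n + 2 * n)"
    using f(1,4) g(1,4) by (intro nb_walk_glue nb_walk_rev sym_adj) auto
  let ?h = "glue (2 * n) f (\<lambda>i. g (2 * n - i))"
  have four: "2 * n + 2 * n = 4 * n" by simp
  have "?h (2 * n + 2 * n) = x"
    by (subst glue_add) (use f(4) g(2,4) in simp_all)
  moreover have "\<forall>i\<le>2 * n + 2 * n. ?h i \<in> S"
    using glue_in[of "2 * n" f S "2 * n" "\<lambda>i. g (2 * n - i)"] f(5) g(5) by simp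
  ultimately show ?thesis
    using walk f(2,4) unfolding four by (intro that[of ?h]) simp_all
qed

lemma opposite_apartment:
  assumes "x \<in> S" "y \<in> S" "d x y = 2 * n"
    and "a \<in> S" "b \<in> S" "a \<noteq> b" "(x, a) \<in> E" "(x, b) \<in> E"
  shows contains_apartment
proof -
  obtain h where h: "nb_walk E h (4 * n)" "h 0 = x" "h (4 * n) = x" "h (2 * n) = y"
    "\<forall>i\<le>4 * n. h i \<in> S" by (rule opposite_closed_walk[OF assms])
  have "h 0 = h (4 * n)" using h(2,3) by simp
  with h(1,5) show ?thesis unfolding contains_apartment_def by blast
qed

text \<open>The apartment contains some \<open>y\<close> opposite \<open>x\<close>, with two
  neighbours of \<open>y\<close> on it. The closed walk in \<open>S\<close> from \<open>y\<close>
  built on these passes \<open>x\<close> halfway, between two different neighbours.\<close>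

lemma two_nbrs_in_S:
  assumes contains_apartment "x \<in> S"
  shows "\<exists>a\<in>S. \<exists>b\<in>S. a \<noteq> b \<and> (x, a) \<in> E \<and> (x, b) \<in> E"
proof -
  obtain h where h: "nb_walk E h (4 * n)" "h 0 = h (4 * n)" "\<forall>i\<le>4 * n. h i \<in> S"
    using assms(1) unfolding contains_apartment_def by blast
  let ?T = "h ` {..4 * n}"
  have T: "\<exists>a\<in>?T. \<exists>b\<in>?T. a \<noteq> b \<and> (v, a) \<in> E \<and> (v, b) \<in> E" if vT: "v \<in> ?T" for v
  proof -
    obtain i where i: "i \<le> 4 * n" "v = h i" using vT by auto
    show ?thesis
    proof (cases "0 < i \<and> i < 4 * n")
      case True
      have "h (i - 1) \<noteq> h (Suc i)" "(h i, h (i - 1)) \<in> E" "(h i, h (Suc i)) \<in> E"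
        using nb_walk_turn[OF h(1), of "i - 1"] nb_walk_edge_back[OF h(1), of i]
          nb_walk_edge[OF h(1), of i] True by auto
      moreover have "h (i - 1) \<in> ?T" "h (Suc i) \<in> ?T" using True by auto
      ultimately show ?thesis unfolding i(2) by blast
    next
      case False
      then have v: "v = h 0" "v = h (4 * n)" using i h(2) by auto
      \<comment> \<open>At the base point the walk gives no turn condition; \<open>h 1\<close> and
        \<open>h (4 * n - 1)\<close> are the ends of a walk of length \<open>4 * n - 2\<close>,
        hence distinct.\<close>
      have "h (1 + 0) \<noteq> h (1 + (4 * n - 2))"
        using two_le by (intro acyclic_belowD[OF girth _ _ nb_walk_shift[OF h(1)]]) auto
      then have "h 1 \<noteq> h (4 * n - 1)" using two_le by (simp add: Suc_diff_Suc numeral_2_eq_2)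
      moreover have "(v, h 1) \<in> E"
        using nb_walk_edge[OF h(1), of 0] two_le unfolding v(1) by simp
      moreover have "(v, h (4 * n - 1)) \<in> E"
        using nb_walk_edge[OF h(1), of "4 * n - 1"] two_le adj_sym unfolding v(2) by simp
      moreover have "h 1 \<in> ?T" "h (4 * n - 1) \<in> ?T" using two_le by auto
      ultimately show ?thesis by blast
    qed
  qed
  have TS: "?T \<subseteq> S" using h(3) by auto
  then have "?T \<subseteq> V" using S_V by blast
  then obtain y where y: "y \<in> ?T" "d x y = 2 * n"
    using exists_opposite[OF S_V[OF assms(2)], of ?T] T by blast
  have yS: "y \<in> S" using y(1) TS by blast
  have dyx: "d y x = 2 * n" using y(2) d_sym[OF S_V[OF assms(2)] S_V[OF yS]] by simp
  obtain a b where ab: "a \<in> S" "b \<in> S" "a \<noteq> b" "(y, a) \<in> E" "(y, b) \<in> E"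
    using T[OF y(1)] TS by blast
  obtain k where k: "nb_walk E k (4 * n)" "k 0 = y" "k (4 * n) = y" "k (2 * n) = x"
    "\<forall>i\<le>4 * n. k i \<in> S" by (rule opposite_closed_walk[OF yS assms(2) dyx ab])
  have "k (2 * n - 1) \<noteq> k (Suc (2 * n))" "(x, k (2 * n - 1)) \<in> E" "(x, k (Suc (2 * n))) \<in> E"
    using nb_walk_turn[OF k(1), of "2 * n - 1"] nb_walk_edge_back[OF k(1), of "2 * n"]
      nb_walk_edge[OF k(1), of "2 * n"] k(4) two_le by auto
  moreover have "k (2 * n - 1) \<in> S" "k (Suc (2 * n)) \<in> S" using k(5) two_le by simp_all
  ultimately show ?thesis by blast
qed

text \<open>A path in \<open>S\<close> from \<open>x\<close> through \<open>y\<close> is brought to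
  length \<open>2 * n\<close>, so that it ends opposite \<open>x\<close>; a return path by another
  neighbour of its end closes it up.\<close>

lemma apartment_in_S:
  assumes contains_apartment "x \<in> S" "y \<in> S"
  obtains h where "nb_walk E h (4 * n)" "h 0 = h (4 * n)" "\<forall>i\<le>4 * n. h i \<in> S"
    "x \<in> h ` {..<4 * n}" "y \<in> h ` {..<4 * n}"
proof -
  note nbrs = two_nbrs_in_S[OF assms(1)]
  have V: "x \<in> V" "y \<in> V" using assms S_V by blast+
  have "\<exists>f. nb_walk E f (2 * n) \<and> f 0 = x \<and> f (d x y) = y \<and> (\<forall>i\<le>2 * n. f i \<in> S)"
  proof (cases "d x y = 2 * n")
    case True
    obtain a where a: "a \<in> S" "(x, a) \<in> E" using nbrs[OF assms(2)] by blast
    obtain f where f: "nb_walk E f (2 * n)" "f 0 = x" "f 1 = a" "f (2 * n) = y"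
      "\<forall>i\<le>2 * n. f i \<in> S" by (rule opposite_path[OF assms(2,3) True a])
    then show ?thesis using True by auto
  next
    case False
    then have lt: "d x y < 2 * n" using d_le[OF V] by simp
    then obtain f where f: "nb_walk E f (d x y)" "f 0 = x" "f (d x y) = y" "\<forall>i\<le>d x y. f i \<in> S"
      by (rule geodesic_in_S[OF assms(2,3)])
    have fS: "f (d x y) \<in> S" using f(4) by simp
    obtain g where g: "nb_walk E g (d x y + (2 * n - d x y))" "\<forall>i\<le>d x y. g i = f i"
      "\<forall>i. d x y \<le> i \<and> i \<le> d x y + (2 * n - d x y) \<longrightarrow> g i \<in> S"
      using nb_walk_extend[OF nbrs f(1) fS, of "2 * n - d x y"] by blast
    have len: "d x y + (2 * n - d x y) = 2 * n" using lt by simp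
    have "g i \<in> S" if "i \<le> 2 * n" for i
      using g(2,3) f(4) that unfolding len by (cases "i \<le> d x y") auto
    then show ?thesis using g(1,2) f(2,3) unfolding len by (intro exI[of _ g]) auto
  qed
  then obtain f where f: "nb_walk E f (2 * n)" "f 0 = x" "f (d x y) = y" "\<forall>i\<le>2 * n. f i \<in> S"
    by blast
  define z where "z = f (2 * n)"
  have z: "z \<in> S" using f(4) by (simp add: z_def)
  have "d x z = 2 * n" using f V z_def by (intro d_nbI[of f]) auto
  then have dzx: "d z x = 2 * n" using d_sym[OF V(1) S_V[OF z]] by simp
  obtain a b where "a \<in> S" "b \<in> S" "a \<noteq> b" "(z, a) \<in> E" "(z, b) \<in> E" using nbrs[OF z] by blast
  then obtain c where c: "c \<in> S" "(z, c) \<in> E" "f (2 * n - 1) \<noteq> c"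
    by (cases "f (2 * n - 1) = a") auto
  obtain g where g: "nb_walk E g (2 * n)" "g 0 = z" "g 1 = c" "g (2 * n) = x"
    "\<forall>i\<le>2 * n. g i \<in> S" by (rule opposite_path[OF z assms(2) dzx c(1,2)])
  let ?h = "glue (2 * n) f g"
  have fg: "f (2 * n) = g 0" using g(2) by (simp add: z_def)
  have four: "2 * n + 2 * n = 4 * n" by simp
  have "nb_walk E ?h (4 * n)"
    unfolding four[symmetric] using f(1) g(1,3) fg c(3) by (intro nb_walk_glue) auto
  moreover have "?h 0 = ?h (4 * n)"
    unfolding four[symmetric] using glue_add[of f "2 * n" g "2 * n", OF fg] f(2) g(4) by simp
  moreover have "\<forall>i\<le>4 * n. ?h i \<in> S"
    unfolding four[symmetric] using glue_in[of "2 * n" f S "2 * n" g] f(4) g(5) by simp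
  moreover have "x \<in> ?h ` {..<4 * n}"
    using f(2) two_le by (intro image_eqI[of _ _ 0]) auto
  moreover have "y \<in> ?h ` {..<4 * n}"
    using f(3) two_le d_le[OF V] by (intro image_eqI[of _ _ "d x y"]) auto
  ultimately show ?thesis by (rule that)
qed

text \<open>The subpolygon is \<open>S\<close> with the induced incidence. It inherits the absence
  of small polygons from \<open>\<Gamma>\<close>; fullness is the condition on lines of a subspace,
  largeness the covering condition.\<close>

lemma apartment_subpolygon:
  assumes contains_apartment
  shows "\<exists>\<Delta>. subpolygon n \<Delta> \<Gamma> \<and> full_in \<Delta> \<Gamma> \<and> large_in n \<Delta> \<Gamma> \<and> S = elements \<Delta>"
proof -
  define \<Delta> where "\<Delta> = \<lparr>points = S \<inter> points \<Gamma>, lines = S \<inter> lines \<Gamma>,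
      incid = incid \<Gamma> \<inter> ((S \<inter> points \<Gamma>) \<times> (S \<inter> lines \<Gamma>))\<rparr>"
  have el: "elements \<Delta> = S" using S_V by (auto simp: elements_def \<Delta>_def)
  have sub: "subgeometry \<Delta> \<Gamma>" by (auto simp: subgeometry_def \<Delta>_def)
  have no_small: "\<not> (\<exists>\<Theta>. subgeometry \<Theta> \<Delta> \<and> ordinary_polygon j \<Theta>)" if "2 \<le> j" "j < 2 * n" for j
  proof -
    have "subgeometry \<Theta> \<Gamma>" if "subgeometry \<Theta> \<Delta>" for \<Theta>
      using that by (auto simp: subgeometry_def \<Delta>_def)
    then show ?thesis using gp that unfolding generalised_polygon_def by blast
  qed
  have joined: "\<exists>\<Theta>. subgeometry \<Theta> \<Delta> \<and> ordinary_polygon (2 * n) \<Theta> \<and> x \<in> elements \<Theta> \<and> y \<in> elements \<Theta>"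
    if xy: "x \<in> S" "y \<in> S" for x y
  proof -
    obtain h where h: "nb_walk E h (4 * n)" "h 0 = h (4 * n)" "\<forall>i\<le>4 * n. h i \<in> S"
      "x \<in> h ` {..<4 * n}" "y \<in> h ` {..<4 * n}" by (rule apartment_in_S[OF assms xy])
    have four: "4 * n = 2 * (2 * n)" by simp
    have "2 \<le> 2 * n" using two_le by simp
    then obtain \<Theta> where \<Theta>: "subgeometry \<Theta> \<Gamma>" "ordinary_polygon (2 * n) \<Theta>"
        "elements \<Theta> = h ` {..<4 * n}"
      using closed_nb_walk_polygon[OF geo h(1)[unfolded four] h(2)[unfolded four] _
          girth[unfolded four]] unfolding four by blast
    have "elements \<Theta> \<subseteq> S" using h(3) unfolding \<Theta>(3) by auto
    then have "subgeometry \<Theta> \<Delta>"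
      using \<Theta>(1) by (auto simp: subgeometry_def \<Delta>_def elements_def)
    then show ?thesis using \<Theta>(2,3) h(4,5) by blast
  qed
  have "geometry \<Delta>" using geo by (auto simp: geometry_def \<Delta>_def)
  moreover have "elements \<Delta> \<noteq> {}" using assms unfolding el contains_apartment_def by auto
  moreover have "2 \<le> 2 * n" using two_le by simp
  ultimately have "generalised_polygon (2 * n) \<Delta>"
    unfolding generalised_polygon_def el using no_small joined by blast
  then have "subpolygon n \<Delta> \<Gamma>" using sub by (simp add: subpolygon_def)
  moreover have "full_in \<Delta> \<Gamma>"
  proof -
    have "\<forall>L \<in> S \<inter> lines \<Gamma>. \<forall>x \<in> points \<Gamma>. (x, L) \<in> incid \<Gamma> \<longrightarrow> x \<in> S"
      using ov unfolding ovoidal_subspace_def subspace_def by (elim conjE)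
    then show ?thesis by (simp add: full_in_def \<Delta>_def)
  qed
  moreover have "large_in n \<Delta> \<Gamma>"
    using ov unfolding large_in_def el ovoidal_subspace_def by (elim conjE)
  ultimately show ?thesis using el by blast
qed

section \<open>Subspaces with lines: opposite pairs and the case of a ball\<close>

text \<open>A point of \<open>S\<close> has odd distance from a line of \<open>S\<close>, hence less
  than \<open>2 * n\<close>, and convexity puts a geodesic into \<open>S\<close>.\<close>

lemma nbr_in_S:
  assumes "\<not> S \<subseteq> points \<Gamma>" "x \<in> S"
  obtains a where "a \<in> S" "(x, a) \<in> E"
proof (cases "x \<in> points \<Gamma>")
  case False
  then show ?thesis using that element_nbrs[OF S_V[OF assms(2)]] line_nbr[OF assms(2)] by blast
next
  case True
  obtain L where L: "L \<in> S" "L \<notin> points \<Gamma>" using assms(1) by blast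
  have odd: "odd (d x L)"
    using d_parity[OF S_V[OF assms(2)] S_V[OF L(1)]] True L(2) by blast
  then have "d x L \<noteq> 2 * n" by auto
  then have "d x L < 2 * n" using d_le[OF S_V[OF assms(2)] S_V[OF L(1)]] by simp
  then obtain f where f: "nb_walk E f (d x L)" "f 0 = x" "f (d x L) = L" "\<forall>i\<le>d x L. f i \<in> S"
    by (rule geodesic_in_S[OF assms(2) L(1)])
  have "0 < d x L" using odd by (rule odd_pos)
  then have "(x, f 1) \<in> E" "f 1 \<in> S" using nb_walk_edge[OF f(1), of 0] f(2,4) by auto
  then show ?thesis using that by blast
qed

text \<open>A pair at maximal distance works. Otherwise its ends are points at distance
  \<open>2 * k\<close> with \<open>k < n\<close>; an element opposite the midpoint \<open>m\<close>
  is covered by some \<open>y\<close> in \<open>S\<close> with \<open>d m y > k\<close>, and leaving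
  one half of the path at \<open>m\<close> towards \<open>y\<close> gives a distance
  \<open>2 * k + 1\<close> in \<open>S\<close>.\<close>

lemma opposite_pair:
  assumes "\<not> S \<subseteq> points \<Gamma>"
  obtains u v where "u \<in> S" "v \<in> S" "d u v = 2 * n"
proof -
  obtain L where "L \<in> S" using assms by blast
  then have "(L, L) \<in> S \<times> S" by simp
  moreover have "\<forall>p. p \<in> S \<times> S \<longrightarrow> (case p of (u, v) \<Rightarrow> d u v) < Suc (2 * n)"
    using d_le[OF S_V S_V] by (auto simp: less_Suc_eq_le)
  ultimately have "\<exists>p. p \<in> S \<times> S \<and>
      (\<forall>q. q \<in> S \<times> S \<longrightarrow> (case q of (u, v) \<Rightarrow> d u v) \<le> (case p of (u, v) \<Rightarrow> d u v))"
    by (rule ex_has_greatest_nat[of "\<lambda>p. p \<in> S \<times> S"])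
  then obtain u v where uv: "u \<in> S" "v \<in> S" and max: "\<And>u' v'. u' \<in> S \<Longrightarrow> v' \<in> S \<Longrightarrow> d u' v' \<le> d u v"
    by fastforce
  have V: "u \<in> V" "v \<in> V" using uv S_V by blast+
  have "d u v = 2 * n"
  proof (rule ccontr)
    assume "d u v \<noteq> 2 * n"
    then have lt: "d u v < 2 * n" using d_le[OF V] by simp
    \<comment> \<open>A line \<open>y\<close> has all its neighbours in \<open>S\<close>, and one of
      them prolongs the geodesic from \<open>x\<close>.\<close>
    have end_point: "y \<in> points \<Gamma>" if xy: "x \<in> S" "y \<in> S" "d x y = d u v" for x y
    proof (rule ccontr)
      assume y: "y \<notin> points \<Gamma>"
      have xyV: "x \<in> V" "y \<in> V" using xy S_V by blast+
      obtain f where f: "nb_walk E f (d x y)" "f 0 = x" "f (d x y) = y" by (rule geodesic[OF xyV])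
      obtain a b where "a \<noteq> b" "(y, a) \<in> E" "(y, b) \<in> E" using element_nbrs[OF xyV(2)] by blast
      then obtain c where c: "(y, c) \<in> E" "c \<noteq> f (d x y - 1)"
        by (cases "a = f (d x y - 1)") auto
      have "nb_walk E (f(Suc (d x y) := c)) (Suc (d x y))"
        using f c by (intro nb_walk_snoc) auto
      then have "d x c = Suc (d x y)"
        using f(2) xyV(1) lt xy(3) by (intro d_nbI[of "f(Suc (d x y) := c)"]) auto
      then show False using max[OF xy(1) line_nbr[OF xy(2) y c(1)]] xy(3) by simp
    qed
    have "d v u = d u v" using d_sym[OF V] by simp
    then have "u \<in> points \<Gamma>" "v \<in> points \<Gamma>" using end_point uv by blast+
    then have "even (d u v)" using d_parity[OF V] by blast
    then obtain k where k: "d u v = 2 * k" by blast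
    obtain f where f: "nb_walk E f (2 * k)" "f 0 = u" "f (2 * k) = v" "\<forall>i\<le>2 * k. f i \<in> S"
      using geodesic_in_S[OF uv lt] unfolding k by blast
    define m where "m = f k"
    have m: "m \<in> S" using f(4) by (simp add: m_def)
    have mV: "m \<in> V" by (rule S_V[OF m])
    obtain x where x: "x \<in> V" "d m x = 2 * n"
      using exists_opposite[OF mV order_refl _ element_nbrs] mV by blast
    obtain y where y: "y \<in> S" "d x y \<le> n" by (rule covering[OF x(1)])
    have "d m x \<le> d m y + d y x" by (rule d_triangle[OF mV S_V[OF y(1)] x(1)])
    then have "n \<le> d m y" using x(2) y(2) d_sym[OF x(1) S_V[OF y(1)]] by simp
    moreover have "k < n" using lt k by simp
    ultimately have km: "Suc k \<le> d m y" by simp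
    have "d m y < 2 * n" using max[OF m y(1)] lt by simp
    then obtain g where g: "nb_walk E g (d m y)" "g 0 = m" "g (d m y) = y" "\<forall>i\<le>d m y. g i \<in> S"
      by (rule geodesic_in_S[OF m y(1)])
    \<comment> \<open>Stated for any \<open>h\<close>, as either half of \<open>f\<close> may be the
      one to use; the guard allows \<open>k = 0\<close>, where no step leads into
      \<open>m\<close>.\<close>
    have too_far: False
      if h: "nb_walk E h (2 * k)" "h 0 \<in> S" "h k = m" "0 < k \<longrightarrow> h (k - 1) \<noteq> g 1" for h
    proof -
      have "nb_walk E (glue k h g) (k + Suc k)"
        using nb_walk_le[OF h(1), of k] nb_walk_le[OF g(1) km] h(3,4) g(2)
        by (intro nb_walk_glue) auto
      moreover have "glue k h g (k + Suc k) = g (Suc k)"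
        using glue_add[of h k g "Suc k"] h(3) g(2) by simp
      ultimately have "d (h 0) (g (Suc k)) = k + Suc k"
        using S_V[OF h(2)] \<open>k < n\<close> by (intro d_nbI[of "glue k h g"]) auto
      then show False using max[OF h(2), of "g (Suc k)"] g(4) km k by simp
    qed
    show False
    proof (cases "0 < k \<and> f (k - 1) = g 1")
      case False
      then show False using too_far[of f] f(1,2) uv(1) m_def by blast
    next
      case True
      have "2 * k - (k - 1) = Suc k" "2 * k - k = k" using True by simp_all
      moreover have "f (Suc k) \<noteq> g 1"
        using nb_walk_turn[OF f(1), of "k - 1"] True by simp
      ultimately show False
        using too_far[of "\<lambda>i. f (2 * k - i)"] nb_walk_rev[OF sym_adj f(1)] f(3) uv(2) m_def by simp
    qed
  qed
  then show ?thesis by (rule that[OF uv])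
qed

text \<open>By \<open>opposite_apartment\<close>, an element of \<open>S\<close> opposite another
  element of \<open>S\<close> now has at most one neighbour in \<open>S\<close>. This keeps
  \<open>S\<close> within distance \<open>n\<close> of the midpoint \<open>m\<close>; the covering
  property gives the converse inclusion.\<close>

lemma no_apartment_ball:
  assumes lines: "\<not> S \<subseteq> points \<Gamma>" and no_apt: "\<not> contains_apartment"
  shows "\<exists>x \<in> V. S = inc_ball \<Gamma> n x \<and> (even n \<longrightarrow> x \<in> points \<Gamma>) \<and> (odd n \<longrightarrow> x \<in> lines \<Gamma>)"
proof -
  obtain u v where uv: "u \<in> S" "v \<in> S" "d u v = 2 * n" by (rule opposite_pair[OF lines])
  have V: "u \<in> V" "v \<in> V" using uv S_V by blast+
  obtain a where a: "a \<in> S" "(u, a) \<in> E" by (rule nbr_in_S[OF lines uv(1)])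
  obtain f where f: "nb_walk E f (2 * n)" "f 0 = u" "f 1 = a" "f (2 * n) = v"
    "\<forall>i\<le>2 * n. f i \<in> S" by (rule opposite_path[OF uv a])
  define m where "m = f n"
  have m: "m \<in> S" using f(5) by (simp add: m_def)
  have mV: "m \<in> V" by (rule S_V[OF m])
  \<comment> \<open>A line would have at least two neighbours, all in \<open>S\<close>.\<close>
  have u_pt: "u \<in> points \<Gamma>"
  proof (rule ccontr)
    assume "u \<notin> points \<Gamma>"
    then show False
      using element_nbrs[OF V(1)] line_nbr[OF uv(1)] opposite_apartment[OF uv] no_apt by blast
  qed
  have um: "d u m = n"
    using nb_walk_le[OF f(1), of n] f(2) V(1) m_def by (intro d_nbI[of f]) auto
  then have m_type: "m \<in> points \<Gamma> \<longleftrightarrow> even n" using d_parity[OF V(1) mV] u_pt by simp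
  \<comment> \<open>If the geodesic \<open>g\<close> went on beyond distance \<open>n\<close>, then
    \<open>g n\<close> would be opposite \<open>u\<close> or \<open>v\<close> and have two
    neighbours in \<open>S\<close>, before and after it on \<open>g\<close>.\<close>
  have le_n_aux: "d m y \<le> n" if y: "y \<in> S" "d m y < 2 * n" for y
  proof (rule ccontr)
    assume "\<not> d m y \<le> n"
    then have gt: "Suc n \<le> d m y" by simp
    obtain g where g: "nb_walk E g (d m y)" "g 0 = m" "g (d m y) = y" "\<forall>i\<le>d m y. g i \<in> S"
      by (rule geodesic_in_S[OF m y])
    have branch: False
      if h: "nb_walk E h (2 * n)" "h 0 \<in> S" "h n = m" "h (n - 1) \<noteq> g 1" for h
    proof -
      have gn: "g n \<in> S" "g (n - 1) \<in> S" "g (Suc n) \<in> S" using g(4) gt by auto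
      have "nb_walk E (glue n h g) (n + n)"
        using nb_walk_le[OF h(1), of n] nb_walk_le[OF g(1), of n] gt h(3,4) g(2)
        by (intro nb_walk_glue) auto
      moreover have "glue n h g (n + n) = g n"
        using glue_add[of h n g n] h(3) g(2) by simp
      ultimately have "d (h 0) (g n) = n + n"
        using S_V[OF h(2)] by (intro d_nbI[of "glue n h g"]) auto
      then have "d (g n) (h 0) = 2 * n" using d_sym[OF S_V[OF h(2)] S_V[OF gn(1)]] by simp
      moreover have "(g n, g (n - 1)) \<in> E" "(g n, g (Suc n)) \<in> E" "g (n - 1) \<noteq> g (Suc n)"
        using nb_walk_edge_back[OF g(1), of n] nb_walk_edge[OF g(1), of n]
          nb_walk_turn[OF g(1), of "n - 1"] gt two_le by auto
      ultimately show False
        using opposite_apartment[OF gn(1) h(2) _ gn(2,3)] no_apt by blast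
    qed
    show False
    proof (cases "f (n - 1) = g 1")
      case False
      then show False using branch[of f] f(1,2) uv(1) m_def by blast
    next
      case True
      have "2 * n - (n - 1) = Suc n" "2 * n - n = n" using two_le by simp_all
      moreover have "f (Suc n) \<noteq> g 1"
        using nb_walk_turn[OF f(1), of "n - 1"] True two_le by simp
      ultimately show False
        using branch[of "\<lambda>i. f (2 * n - i)"] nb_walk_rev[OF sym_adj f(1)] f(4) uv(2) m_def by simp
    qed
  qed
  \<comment> \<open>Elements opposite \<open>m\<close> escape convexity. A neighbour of such a
    \<open>y\<close> in \<open>S\<close> has distance above \<open>n\<close>, hence also
    \<open>2 * n\<close>, from \<open>m\<close>, against parity.\<close>
  have le_n: "d m y \<le> n" if y: "y \<in> S" for y
  proof (cases "d m y = 2 * n")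
    case False
    then show ?thesis using le_n_aux[OF y] d_le[OF mV S_V[OF y]] by simp
  next
    case True
    obtain z where z: "z \<in> S" "(y, z) \<in> E" by (rule nbr_in_S[OF lines y])
    have zy: "d z y \<le> 1"
      using adj_sym[OF z(2)] S_V y z(1) by (intro d_le_relpow) auto
    have "d m y \<le> d m z + d z y" by (rule d_triangle[OF mV S_V[OF z(1)] S_V[OF y]])
    then have "n < d m z" using zy True two_le by linarith
    then have "d m z = 2 * n" using le_n_aux[OF z(1)] d_le[OF mV S_V[OF z(1)]] by fastforce
    then show ?thesis
      using True d_parity[OF mV S_V[OF z(1)]] d_parity[OF mV S_V[OF y]] adj_points[OF geo z(2)] by simp
  qed
  have ball_in_S: "y \<in> S" if y: "y \<in> V" "d m y \<le> n" for y
  proof (rule ccontr)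
    assume yS: "y \<notin> S"
    obtain g where g: "nb_walk E g (d m y)" "g 0 = m" "g (d m y) = y" by (rule geodesic[OF mV y(1)])
    \<comment> \<open>The first exit of the geodesic from \<open>S\<close>. Its predecessor
      \<open>s\<close> must be a point, as lines of \<open>S\<close> have all their neighbours in
      \<open>S\<close>.\<close>
    define j where "j = (LEAST j. g j \<notin> S)"
    have gj: "g j \<notin> S" unfolding j_def by (rule LeastI[of _ "d m y"]) (use g(3) yS in simp)
    have j_le: "j \<le> d m y" unfolding j_def by (rule Least_le) (use g(3) yS in simp)
    have "j \<noteq> 0" using gj g(2) m by metis
    then obtain i where i: "j = Suc i" by (cases j) auto
    define s where "s = g i"
    have s: "s \<in> S" using not_less_Least[of i "\<lambda>j. g j \<notin> S"] i unfolding j_def[symmetric] s_def by simp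
    have st: "(s, g (Suc i)) \<in> E" using nb_walk_edge[OF g(1), of i] j_le i by (simp add: s_def)
    have s_pt: "s \<in> points \<Gamma>" using line_nbr[OF s _ st] gj i by blast
    have ms: "d m s = i"
      using nb_walk_le[OF g(1), of i] g(2) mV j_le i y(2) s_def by (intro d_nbI[of g]) auto
    have "i < n" using j_le i y(2) by simp
    moreover have "even n \<longleftrightarrow> even i" using d_parity[OF mV S_V[OF s]] m_type s_pt ms by simp
    \<comment> \<open>Equal parity improves \<open>i < n\<close> to \<open>i \<le> n - 2\<close>,
      whence \<open>2 * n - 1 - i\<close> exceeds \<open>n\<close>.\<close>
    ultimately have i_lt: "Suc i < n" by (cases "Suc i = n") auto
    have tV: "g (Suc i) \<in> V" by (rule E_in_V(2)[OF st])
    \<comment> \<open>Walk on from \<open>s\<close> through \<open>g (Suc i)\<close> to an element \<open>p l\<close> with \<open>l = d s (p l) = 2 * n - 1 - i\<close>.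
      Walks from \<open>S\<close> to it via \<open>s\<close> do not backtrack and have length between \<open>n + 1\<close> and \<open>3 * n - 1\<close>,
      so its distance from \<open>S\<close> exceeds \<open>n\<close>.\<close>
    have walk_t: "nb_walk E (\<lambda>j. g (i + j)) 1"
      using j_le i by (intro nb_walk_shift[OF g(1)]) simp
    obtain p where p: "nb_walk E p (1 + (2 * n - 2 - i))" "\<forall>j\<le>1. p j = g (i + j)"
      using nb_walk_extend[OF element_nbrs walk_t, of "2 * n - 2 - i"] tV by auto
    define l where "l = 2 * n - 1 - i"
    have l: "1 + (2 * n - 2 - i) = l" using i_lt by (simp add: l_def)
    note p = p[unfolded l]
    have p01: "p 0 = s" "p 1 = g (Suc i)" using p(2) by (simp_all add: s_def)
    have wV: "p l \<in> V" using nb_walk_in_V[OF p(1)] p01(1) S_V[OF s] by simp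
    obtain z where z: "z \<in> S" "d (p l) z \<le> n" by (rule covering[OF wV])
    have zw: "d z (p l) \<le> n" using d_sym[OF wV S_V[OF z(1)]] z(2) by simp
    have "d z s \<le> d z m + d m s" by (rule d_triangle[OF S_V[OF z(1)] mV S_V[OF s]])
    then have zs: "d z s \<le> n + i"
      using le_n[OF z(1)] d_sym[OF mV S_V[OF z(1)]] ms by simp
    then have "d z s < 2 * n" using i_lt by simp
    then obtain q where q: "nb_walk E q (d z s)" "q 0 = z" "q (d z s) = s" "\<forall>i\<le>d z s. q i \<in> S"
      by (rule geodesic_in_S[OF z(1) s])
    \<comment> \<open>The left side lies in \<open>S\<close>, the right side does not. For
      \<open>z = s\<close> the index is \<open>0\<close> and the left side is
      \<open>s\<close>.\<close>
    have "q (d z s - 1) \<noteq> p 1" using q(4) gj i p01(2) by (metis diff_le_self)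
    then have walk: "nb_walk E (glue (d z s) q p) (d z s + l)"
      using q(1,3) p(1) p01(1) by (intro nb_walk_glue) simp_all
    have "glue (d z s) q p (d z s + l) = p l"
      using glue_add[of q "d z s" p l] q(3) p01(1) by simp
    then have "d z (p l) = d z s + l \<or> 4 * n \<le> d z s + l + d z (p l)"
      using q(2) S_V[OF z(1)] by (intro d_nb_long[OF walk]) simp_all
    then show False using zw zs i_lt unfolding l_def by linarith
  qed
  have "S = inc_ball \<Gamma> n m"
    using le_n ball_in_S S_V inc_dist_eq[OF mV] by (auto simp: inc_ball_def)
  moreover have "odd n \<longrightarrow> m \<in> lines \<Gamma>" using m_type mV by (auto simp: elements_def)
  ultimately show ?thesis using mV m_type by blast
qed

end

theorem theorem2p8:
  fixes \<Gamma> :: "'a geometry" and n :: nat and S :: "'a set"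
  assumes "n \<ge> 2"
    and "generalised_polygon (2 * n) \<Gamma>"
    and "ovoidal_subspace n \<Gamma> S"
  shows "distance_ovoid n \<Gamma> S
    \<or> (\<exists>\<Delta>. subpolygon n \<Delta> \<Gamma> \<and> full_in \<Delta> \<Gamma> \<and> large_in n \<Delta> \<Gamma> \<and> S = elements \<Delta>)
    \<or> (\<exists>x \<in> elements \<Gamma>. S = inc_ball \<Gamma> n x
         \<and> (even n \<longrightarrow> x \<in> points \<Gamma>) \<and> (odd n \<longrightarrow> x \<in> lines \<Gamma>))"
proof -
  interpret ovoidal \<Gamma> n S
    by unfold_locales (use assms in simp_all)
  \<comment> \<open>The cases are whether \<open>S\<close> consists of points and, if not, whether
    it contains an apartment.\<close>
  show ?thesis
    using point_set_distance_ovoid apartment_subpolygon no_apartment_ball by blast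
qed

end
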